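(* Let $R$ be a ring, $J$ a complete ideal filter of $R$ and $T$ a $J$-torsion and $J$-injective left $R$-module. Every $T$-pointed $R$-module $(M,s)$ admits a maximal $(J,T)$-extension. Moreover, for any maximal $(J,T)$-extension $(\Gamma,\iota,\tau)$ of $M$ the following hold: 1. if $\Gamma'$ is another maximal $(J,T)$-extension of $M$, then $\Gamma\cong\Gamma'$ as $(J,T)$-extensions; 2. the module $\Gamma$ is saturated; 3. the module $\Gamma$ is $J$-injective; 4. if $(N,i,t)$ is a $(J,T)$-extension of $M$ and $\varphi:N\to\Gamma$ is a map of $(J,T)$-extensions, then $(\Gamma,\varphi,\tau)$ is a maximal $(J,T)$-extension of $(N,t)$.
   Context: Rings are unitary, not necessarily commutative; modules are left modules. An ideal filter of $R$ is a non-empty set $J$ of right ideals of $R$ closed under pairwise intersection and such that any right ideal containing an element of $J$ is in $J$. For left $R$-modules $A\subseteq B$, $(A:_BJ):=\{x\in B\mid Ix\subseteq A\text{ for some }I\in J\}$, a submodule of $B$; $B[J]:=(0:_BJ)$, and $B$ is $J$-torsion if $B=B[J]$. $J$ is complete if $((A:_BJ):_BJ)=(A:_BJ)$ for all $A\subseteq B$. A $J$-extension is an injective $R$-homomorphism $i:A\hookrightarrow B$ with $(i(A):_BJ)=B$. A left $R$-module $Q$ is $J$-injective if for every $J$-extension $i:A\hookrightarrow B$ every $R$-homomorphism $f:A\to Q$ is of the form $g\circ i$ for some $R$-homomorphism $g:B\to Q$. A $T$-pointed $R$-module is a pair $(M,s)$ with $M$ a left $R$-module and $s:M[J]\hookrightarrow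 T$ an injective homomorphism; it is saturated if $s$ is surjective. A map $\varphi:(L,r)\to(M,s)$ of $T$-pointed $R$-modules is an $R$-homomorphism with $s\circ\varphi|_{L[J]}=r$. A $(J,T)$-extension of $(M,s)$ is a triple $(N,i,t)$ with $(N,t)$ a $T$-pointed $R$-module and $i:M\hookrightarrow N$ a map of $T$-pointed $R$-modules which is a $J$-extension. A map of $(J,T)$-extensions $(N,i,t)\to(P,j,u)$ is a map $f$ of $T$-pointed $R$-modules with $f\circ i=j$. A $(J,T)$-extension $\Gamma$ of $M$ is maximal if for every $(J,T)$-extension $N$ of $M$ there is a map of $(J,T)$-extensions $N\to\Gamma$. *)

theory Defs
  imports "HOL-Algebra.Algebra"
begin

text \<open>
  The locale \<open>module\<close> of HOL-Algebra requires a commutative ring of scalars, so left modules over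
  an arbitrary unital ring are introduced here, on the same record type. As usual for that record,
  the fields \<open>mult\<close> and \<open>one\<close> of a module carry no meaning.
\<close>

locale left_module = R?: ring R + M?: abelian_group M
  for R :: "('r, 'k) ring_scheme" (structure) and M :: "('r, 'm, 'x) module_scheme" (structure) +
  assumes smult_closed:
      "\<lbrakk>a \<in> carrier R; x \<in> carrier M\<rbrakk> \<Longrightarrow> a \<odot>\<^bsub>M\<^esub> x \<in> carrier M"
    and smult_l_distr:
      "\<lbrakk>a \<in> carrier R; b \<in> carrier R; x \<in> carrier M\<rbrakk> \<Longrightarrow>
        (a \<oplus> b) \<odot>\<^bsub>M\<^esub> x = a \<odot>\<^bsub>M\<^esub> x \<oplus>\<^bsub>M\<^esub> b \<odot>\<^bsub>M\<^esub> x"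
    and smult_r_distr:
      "\<lbrakk>a \<in> carrier R; x \<in> carrier M; y \<in> carrier M\<rbrakk> \<Longrightarrow>
        a \<odot>\<^bsub>M\<^esub> (x \<oplus>\<^bsub>M\<^esub> y) = a \<odot>\<^bsub>M\<^esub> x \<oplus>\<^bsub>M\<^esub> a \<odot>\<^bsub>M\<^esub> y"
    and smult_assoc1:
      "\<lbrakk>a \<in> carrier R; b \<in> carrier R; x \<in> carrier M\<rbrakk> \<Longrightarrow>
        (a \<otimes> b) \<odot>\<^bsub>M\<^esub> x = a \<odot>\<^bsub>M\<^esub> (b \<odot>\<^bsub>M\<^esub> x)"
    and smult_one:
      "x \<in> carrier M \<Longrightarrow> \<one> \<odot>\<^bsub>M\<^esub> x = x"

definition left_module_hom ::
  "('r, 'k) ring_scheme \<Rightarrow> ('r, 'a, 'x) module_scheme \<Rightarrow> ('r, 'b, 'y) module_scheme \<Rightarrow> ('a \<Rightarrow> 'b) set"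
  where "left_module_hom R A B = {f. f \<in> carrier A \<rightarrow> carrier B \<and>
    (\<forall>x\<in>carrier A. \<forall>y\<in>carrier A. f (x \<oplus>\<^bsub>A\<^esub> y) = f x \<oplus>\<^bsub>B\<^esub> f y) \<and>
    (\<forall>a\<in>carrier R. \<forall>x\<in>carrier A. f (a \<odot>\<^bsub>A\<^esub> x) = a \<odot>\<^bsub>B\<^esub> f x)}"

locale right_ideal = additive_subgroup I R for I and R (structure) +
  assumes I_r_closed: "\<lbrakk>a \<in> I; x \<in> carrier R\<rbrakk> \<Longrightarrow> a \<otimes> x \<in> I"

definition ideal_filter :: "('r, 'k) ring_scheme \<Rightarrow> 'r set set \<Rightarrow> bool"
  where "ideal_filter R J \<longleftrightarrow>
    J \<noteq> {} \<and> (\<forall>I\<in>J. right_ideal I R) \<and>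
    (\<forall>I\<in>J. \<forall>K\<in>J. I \<inter> K \<in> J) \<and>
    (\<forall>I\<in>J. \<forall>K. right_ideal K R \<and> I \<subseteq> K \<longrightarrow> K \<in> J)"

text \<open>\<open>colon J B A\<close> is \<open>(A :\<^sub>B J)\<close>.\<close>

definition colon :: "'r set set \<Rightarrow> ('r, 'b, 'y) module_scheme \<Rightarrow> 'b set \<Rightarrow> 'b set"
  where "colon J B A = {x \<in> carrier B. \<exists>I\<in>J. (\<lambda>a. a \<odot>\<^bsub>B\<^esub> x) ` I \<subseteq> A}"

definition torsion :: "'r set set \<Rightarrow> ('r, 'b, 'y) module_scheme \<Rightarrow> 'b set"
  where "torsion J B = colon J B {\<zero>\<^bsub>B\<^esub>}"

definition is_torsion :: "'r set set \<Rightarrow> ('r, 'b, 'y) module_scheme \<Rightarrow> bool"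
  where "is_torsion J B \<longleftrightarrow> torsion J B = carrier B"

text \<open>
  The notions below that quantify over all modules take the carrier type (or types) of these modules
  as an explicit argument, since a formula cannot quantify over types.
\<close>

definition complete_filter :: "'b itself \<Rightarrow> ('r, 'k) ring_scheme \<Rightarrow> 'r set set \<Rightarrow> bool"
  where "complete_filter _ R J \<longleftrightarrow>
    (\<forall>(B :: ('r, 'b) module) A. left_module R B \<and> submodule A R B \<longrightarrow>
      colon J B (colon J B A) = colon J B A)"

definition J_extension ::
  "('r, 'k) ring_scheme \<Rightarrow> 'r set set \<Rightarrow> ('r, 'a, 'x) module_scheme \<Rightarrow> ('r, 'b, 'y) module_scheme \<Rightarrow>
    ('a \<Rightarrow> 'b) \<Rightarrow> bool"
  where "J_extension R J A B i \<longleftrightarrow>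
    left_module R A \<and> left_module R B \<and> i \<in> left_module_hom R A B \<and> inj_on i (carrier A) \<and>
    colon J B (i ` carrier A) = carrier B"

definition J_injective ::
  "'a itself \<Rightarrow> 'b itself \<Rightarrow> ('r, 'k) ring_scheme \<Rightarrow> 'r set set \<Rightarrow> ('r, 'q, 'z) module_scheme \<Rightarrow> bool"
  where "J_injective _ _ R J Q \<longleftrightarrow>
    (\<forall>(A :: ('r, 'a) module) (B :: ('r, 'b) module) i f.
      J_extension R J A B i \<and> f \<in> left_module_hom R A Q \<longrightarrow>
      (\<exists>g \<in> left_module_hom R B Q. \<forall>x\<in>carrier A. f x = g (i x)))"

definition pointed_module ::
  "('r, 'k) ring_scheme \<Rightarrow> 'r set set \<Rightarrow> ('r, 't, 'y) module_scheme \<Rightarrow> ('r, 'm, 'x) module_scheme \<Rightarrow>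
    ('m \<Rightarrow> 't) \<Rightarrow> bool"
  where "pointed_module R J T M s \<longleftrightarrow>
    left_module R M \<and> s \<in> left_module_hom R (M\<lparr>carrier := torsion J M\<rparr>) T \<and>
    inj_on s (torsion J M)"

definition saturated ::
  "'r set set \<Rightarrow> ('r, 't, 'y) module_scheme \<Rightarrow> ('r, 'm, 'x) module_scheme \<Rightarrow> ('m \<Rightarrow> 't) \<Rightarrow> bool"
  where "saturated J T M s \<longleftrightarrow> s ` torsion J M = carrier T"

definition pointed_map ::
  "('r, 'k) ring_scheme \<Rightarrow> 'r set set \<Rightarrow> ('r, 'l, 'x) module_scheme \<Rightarrow> ('l \<Rightarrow> 't) \<Rightarrow>
    ('r, 'm, 'y) module_scheme \<Rightarrow> ('m \<Rightarrow> 't) \<Rightarrow> ('l \<Rightarrow> 'm) \<Rightarrow> bool"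
  where "pointed_map R J L r M s \<phi> \<longleftrightarrow>
    \<phi> \<in> left_module_hom R L M \<and> (\<forall>x\<in>torsion J L. s (\<phi> x) = r x)"

definition JT_extension ::
  "('r, 'k) ring_scheme \<Rightarrow> 'r set set \<Rightarrow> ('r, 't, 'z) module_scheme \<Rightarrow>
    ('r, 'm, 'x) module_scheme \<Rightarrow> ('m \<Rightarrow> 't) \<Rightarrow>
    ('r, 'n, 'y) module_scheme \<Rightarrow> ('m \<Rightarrow> 'n) \<Rightarrow> ('n \<Rightarrow> 't) \<Rightarrow> bool"
  where "JT_extension R J T M s N i t \<longleftrightarrow>
    pointed_module R J T N t \<and> pointed_map R J M s N t i \<and> J_extension R J M N i"

definition JT_map ::
  "('r, 'k) ring_scheme \<Rightarrow> 'r set set \<Rightarrow> ('r, 'm, 'x) module_scheme \<Rightarrow>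
    ('r, 'n, 'y) module_scheme \<Rightarrow> ('m \<Rightarrow> 'n) \<Rightarrow> ('n \<Rightarrow> 't) \<Rightarrow>
    ('r, 'p, 'z) module_scheme \<Rightarrow> ('m \<Rightarrow> 'p) \<Rightarrow> ('p \<Rightarrow> 't) \<Rightarrow> ('n \<Rightarrow> 'p) \<Rightarrow> bool"
  where "JT_map R J M N i t P j u f \<longleftrightarrow>
    pointed_map R J N t P u f \<and> (\<forall>x\<in>carrier M. f (i x) = j x)"

definition JT_iso ::
  "('r, 'k) ring_scheme \<Rightarrow> 'r set set \<Rightarrow> ('r, 'm, 'x) module_scheme \<Rightarrow>
    ('r, 'n, 'y) module_scheme \<Rightarrow> ('m \<Rightarrow> 'n) \<Rightarrow> ('n \<Rightarrow> 't) \<Rightarrow>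
    ('r, 'p, 'z) module_scheme \<Rightarrow> ('m \<Rightarrow> 'p) \<Rightarrow> ('p \<Rightarrow> 't) \<Rightarrow> bool"
  where "JT_iso R J M N i t P j u \<longleftrightarrow>
    (\<exists>f g. JT_map R J M N i t P j u f \<and> JT_map R J M P j u N i t g \<and>
      (\<forall>x\<in>carrier N. g (f x) = x) \<and> (\<forall>y\<in>carrier P. f (g y) = y))"

definition maximal_JT_extension ::
  "'n itself \<Rightarrow> ('r, 'k) ring_scheme \<Rightarrow> 'r set set \<Rightarrow> ('r, 't, 'z) module_scheme \<Rightarrow>
    ('r, 'm, 'x) module_scheme \<Rightarrow> ('m \<Rightarrow> 't) \<Rightarrow>
    ('r, 'g, 'y) module_scheme \<Rightarrow> ('m \<Rightarrow> 'g) \<Rightarrow> ('g \<Rightarrow> 't) \<Rightarrow> bool"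
  where "maximal_JT_extension _ R J T M s \<Gamma> \<iota> \<tau> \<longleftrightarrow>
    JT_extension R J T M s \<Gamma> \<iota> \<tau> \<and>
    (\<forall>(N :: ('r, 'n) module) i t. JT_extension R J T M s N i t \<longrightarrow>
      (\<exists>f. JT_map R J M N i t \<Gamma> \<iota> \<tau> f))"

text \<open>
  The carrier type over which the module quantifiers in hypotheses range. It is large enough to be no
  restriction. For completeness of \<open>J\<close> it suffices to test submodules of \<open>R\<close> itself, and for
  \<open>J\<close>-injectivity the inclusions of left ideals in \<open>R\<close> (Baer's criterion). For maximality it
  suffices that every \<open>(J,T)\<close>-extension \<open>(N, i, t)\<close> of \<open>(M, s)\<close>, on whatever type, has an isomorphic
  copy in the universe: given \<open>x\<close> in \<open>N\<close>, choose \<open>I \<in> J\<close> with \<open>I x \<subseteq> i(M)\<close>; then \<open>I\<close> and the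
  function \<open>a \<mapsto> i\<inverse>(a x)\<close> on \<open>I\<close> determine \<open>x\<close> up to \<open>N[J]\<close>, and \<open>t\<close> embeds \<open>N[J]\<close> into \<open>T\<close>.
  So \<open>N\<close> injects into \<open>'r set \<times> ('r \<Rightarrow> 'm) \<times> 't\<close>, which injects into the type below.
\<close>

type_synonym ('r, 'm, 't) univ = "(nat \<times> 'r \<times> 'm \<times> 't) set"

end

theory Submission
  imports Defs
begin

text \<open>
  A \<open>(J,T)\<close>-extension \<open>\<Gamma>\<close> of \<open>M\<close> is maximal if and only if it is saturated and \<open>J\<close>-injective, where
  \<open>J\<close>-injectivity can be tested on left ideals of \<open>R\<close>. If \<open>\<Gamma>\<close> is saturated and \<open>J\<close>-injective and \<open>N\<close>
  is a \<open>(J,T)\<close>-extension of \<open>M\<close>, a map \<open>M + N[J] \<rightarrow> \<Gamma>\<close> is forced, and extends to \<open>N\<close>. Conversely, any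
  map from such a \<open>\<Gamma>\<close> to a \<open>(J,T)\<close>-extension is bijective: it is injective, it splits up to torsion,
  and all torsion already comes from \<open>\<Gamma>\<close>. So everything follows once one saturated \<open>J\<close>-injective
  extension is known to exist. It suffices to adjoin \<open>T\<close> and, for each homomorphism \<open>L \<rightarrow> M\<close> on a left
  ideal \<open>L\<close> containing an element of \<open>J\<close>, one element inducing it, and to divide out excess torsion
  by means of the injectivity of \<open>T\<close>; by completeness of \<open>J\<close> a single such step is enough.
\<close>

section \<open>Left modules\<close>

text \<open>Two obstacles shape the development. First, the hypotheses quantify over modules on one
  fixed carrier type, while the conclusions concern arbitrary types. Completeness and
  \<open>J\<close>-injectivity are therefore reduced to statements about left ideals of
  \<open>R\<close> (the locale \<open>complete_filtered_ring\<close> and the predicate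
  \<open>baer\<close>), which mention no type of test modules. A maximal \<Gamma> is only known to
  receive maps from extensions on \<open>univ\<close>, so the constructed extension has to be moved
  there. Second, adjoining solutions freely may create torsion that does not embed into
  \<open>T\<close>. Dividing out all torsion would destroy \<open>M[J]\<close> and \<open>T\<close>;
  instead the torsion part is mapped to \<open>T\<close> compatibly with \<open>s\<close>, and only
  the kernel of that map is divided out. Two kinds of ideals interact: members of \<open>J\<close>
  are right ideals, domains of extension problems are left ideals \<open>L\<close> containing some
  \<open>I\<close> in \<open>J\<close>. Right multiplication stays inside \<open>I\<close>, so
  \<open>I r \<subseteq> L\<close> for every scalar \<open>r\<close>; this is what makes
  \<open>L \<subseteq> R\<close> a \<open>J\<close>-extension.\<close>

lemma (in abelian_group) a_inv_zero: "\<ominus> \<zero> = \<zero>"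
  by (rule minus_equality) auto

lemma (in abelian_group) minus_eq_zero_iff:
  "\<lbrakk>x \<in> carrier G; y \<in> carrier G\<rbrakk> \<Longrightarrow> x \<ominus> y = \<zero> \<longleftrightarrow> x = y"
  by (metis a_inv_closed a_minus_def minus_equality minus_minus r_neg)

lemma (in abelian_group) add_minus_cancel:
  "\<lbrakk>x \<in> carrier G; y \<in> carrier G\<rbrakk> \<Longrightarrow> x \<oplus> (y \<ominus> x) = y"
  by (metis a_assoc a_comm a_inv_closed a_minus_def l_neg l_zero)

context left_module
begin

lemma smult_r_null: "a \<in> carrier R \<Longrightarrow> a \<odot>\<^bsub>M\<^esub> \<zero>\<^bsub>M\<^esub> = \<zero>\<^bsub>M\<^esub>"
  using smult_r_distr[of a "\<zero>\<^bsub>M\<^esub>" "\<zero>\<^bsub>M\<^esub>"] smult_closed[of a "\<zero>\<^bsub>M\<^esub>"]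
  by (metis M.add.l_cancel_one' M.add.one_closed M.add.r_one)

lemma smult_l_null: "x \<in> carrier M \<Longrightarrow> \<zero> \<odot>\<^bsub>M\<^esub> x = \<zero>\<^bsub>M\<^esub>"
  using smult_l_distr[of \<zero> \<zero> x] smult_closed[of \<zero> x]
  by (metis M.add.l_cancel_one' R.add.one_closed R.add.r_one)

lemma smult_r_minus:
  assumes "a \<in> carrier R" "x \<in> carrier M"
  shows "a \<odot>\<^bsub>M\<^esub> (\<ominus>\<^bsub>M\<^esub> x) = \<ominus>\<^bsub>M\<^esub> (a \<odot>\<^bsub>M\<^esub> x)"
proof (rule M.minus_equality[symmetric])
  show "a \<odot>\<^bsub>M\<^esub> (\<ominus>\<^bsub>M\<^esub> x) \<oplus>\<^bsub>M\<^esub> a \<odot>\<^bsub>M\<^esub> x = \<zero>\<^bsub>M\<^esub>"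
    using assms by (simp add: smult_r_distr[symmetric] M.l_neg smult_r_null)
qed (use assms in \<open>auto intro: smult_closed\<close>)

lemma smult_l_minus:
  assumes "a \<in> carrier R" "x \<in> carrier M"
  shows "(\<ominus> a) \<odot>\<^bsub>M\<^esub> x = \<ominus>\<^bsub>M\<^esub> (a \<odot>\<^bsub>M\<^esub> x)"
proof (rule M.minus_equality[symmetric])
  show "(\<ominus> a) \<odot>\<^bsub>M\<^esub> x \<oplus>\<^bsub>M\<^esub> a \<odot>\<^bsub>M\<^esub> x = \<zero>\<^bsub>M\<^esub>"
    using assms by (simp add: smult_l_distr[symmetric] R.l_neg smult_l_null)
qed (use assms in \<open>auto intro: smult_closed\<close>)

lemma smult_r_diff:
  "\<lbrakk>a \<in> carrier R; x \<in> carrier M; y \<in> carrier M\<rbrakk> \<Longrightarrow>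
    a \<odot>\<^bsub>M\<^esub> (x \<ominus>\<^bsub>M\<^esub> y) = a \<odot>\<^bsub>M\<^esub> x \<ominus>\<^bsub>M\<^esub> a \<odot>\<^bsub>M\<^esub> y"
  by (simp add: a_minus_def smult_r_distr smult_r_minus)

text \<open>Closure under negation comes for free from the scalar -1. The predicate
  \<open>submodule\<close> only asks for an additive subgroup closed under scalars, so it is
  meaningful over a noncommutative \<open>R\<close>.\<close>

lemma left_submoduleI:
  assumes "A \<subseteq> carrier M" "\<zero>\<^bsub>M\<^esub> \<in> A"
    and "\<And>x y. \<lbrakk>x \<in> A; y \<in> A\<rbrakk> \<Longrightarrow> x \<oplus>\<^bsub>M\<^esub> y \<in> A"
    and smult: "\<And>a x. \<lbrakk>a \<in> carrier R; x \<in> A\<rbrakk> \<Longrightarrow> a \<odot>\<^bsub>M\<^esub> x \<in> A"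
  shows "submodule A R M"
proof (intro submodule.intro subgroup.intro)
  fix x assume x: "x \<in> A"
  then have "(\<ominus> \<one>) \<odot>\<^bsub>M\<^esub> x = \<ominus>\<^bsub>M\<^esub> x"
    using assms(1) by (subst smult_l_minus) (auto simp: smult_one)
  moreover have "(\<ominus> \<one>) \<odot>\<^bsub>M\<^esub> x \<in> A"
    using x smult by simp
  ultimately have "\<ominus>\<^bsub>M\<^esub> x \<in> A"
    by simp
  then show "inv\<^bsub>add_monoid M\<^esub> x \<in> A"
    by (simp add: a_inv_def)
qed (use assms in \<open>auto simp: submodule_axioms_def\<close>)

lemma left_submoduleD:
  assumes "submodule A R M"
  shows "A \<subseteq> carrier M" "\<zero>\<^bsub>M\<^esub> \<in> A"
    and "\<And>x. x \<in> A \<Longrightarrow> x \<in> carrier M"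
    and "\<And>x y. \<lbrakk>x \<in> A; y \<in> A\<rbrakk> \<Longrightarrow> x \<oplus>\<^bsub>M\<^esub> y \<in> A"
    and "\<And>x. x \<in> A \<Longrightarrow> \<ominus>\<^bsub>M\<^esub> x \<in> A"
    and "\<And>x y. \<lbrakk>x \<in> A; y \<in> A\<rbrakk> \<Longrightarrow> x \<ominus>\<^bsub>M\<^esub> y \<in> A"
    and "\<And>a x. \<lbrakk>a \<in> carrier R; x \<in> A\<rbrakk> \<Longrightarrow> a \<odot>\<^bsub>M\<^esub> x \<in> A"
proof -
  interpret A: submodule A R M
    by fact
  show *: "A \<subseteq> carrier M" "\<zero>\<^bsub>M\<^esub> \<in> A"
    "\<And>x y. \<lbrakk>x \<in> A; y \<in> A\<rbrakk> \<Longrightarrow> x \<oplus>\<^bsub>M\<^esub> y \<in> A"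
    "\<And>x. x \<in> A \<Longrightarrow> \<ominus>\<^bsub>M\<^esub> x \<in> A"
    "\<And>a x. \<lbrakk>a \<in> carrier R; x \<in> A\<rbrakk> \<Longrightarrow> a \<odot>\<^bsub>M\<^esub> x \<in> A"
    using A.subset A.one_closed A.m_closed A.m_inv_closed by (auto simp: a_inv_def)
  show "\<And>x. x \<in> A \<Longrightarrow> x \<in> carrier M"
    using * by auto
  show "\<And>x y. \<lbrakk>x \<in> A; y \<in> A\<rbrakk> \<Longrightarrow> x \<ominus>\<^bsub>M\<^esub> y \<in> A"
    using * by (simp add: a_minus_def)
qed

lemma left_submodule_carrier: "submodule (carrier M) R M"
  by (rule left_submoduleI) (auto intro: smult_closed)

lemma left_submodule_zero: "submodule {\<zero>\<^bsub>M\<^esub>} R M"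
  by (rule left_submoduleI) (auto simp: smult_r_null)

lemma left_module_submodule:
  assumes "submodule A R M"
  shows "left_module R (M\<lparr>carrier := A\<rparr>)"
proof -
  note A = left_submoduleD[OF assms]
  have "abelian_group (M\<lparr>carrier := A\<rparr>)"
  proof (rule abelian_groupI)
    fix x assume "x \<in> carrier (M\<lparr>carrier := A\<rparr>)"
    then show "\<exists>y\<in>carrier (M\<lparr>carrier := A\<rparr>).
        y \<oplus>\<^bsub>M\<lparr>carrier := A\<rparr>\<^esub> x = \<zero>\<^bsub>M\<lparr>carrier := A\<rparr>\<^esub>"
      using A by (auto intro!: bexI[of _ "\<ominus>\<^bsub>M\<^esub> x"] simp: M.l_neg)
  qed (use A in \<open>auto simp: M.a_ac\<close>)
  then show ?thesis
    using A
    by (intro left_module.intro left_module_axioms.intro)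
      (auto simp: R.ring_axioms smult_l_distr smult_r_distr smult_assoc1 smult_one)
qed

end

lemma left_moduleI:
  fixes R (structure) and M (structure)
  assumes "ring R" "abelian_group M"
    and "\<And>a x. \<lbrakk>a \<in> carrier R; x \<in> carrier M\<rbrakk> \<Longrightarrow> a \<odot>\<^bsub>M\<^esub> x \<in> carrier M"
    and "\<And>a b x. \<lbrakk>a \<in> carrier R; b \<in> carrier R; x \<in> carrier M\<rbrakk> \<Longrightarrow>
      (a \<oplus> b) \<odot>\<^bsub>M\<^esub> x = a \<odot>\<^bsub>M\<^esub> x \<oplus>\<^bsub>M\<^esub> b \<odot>\<^bsub>M\<^esub> x"
    and "\<And>a x y. \<lbrakk>a \<in> carrier R; x \<in> carrier M; y \<in> carrier M\<rbrakk> \<Longrightarrow>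
      a \<odot>\<^bsub>M\<^esub> (x \<oplus>\<^bsub>M\<^esub> y) = a \<odot>\<^bsub>M\<^esub> x \<oplus>\<^bsub>M\<^esub> a \<odot>\<^bsub>M\<^esub> y"
    and "\<And>a b x. \<lbrakk>a \<in> carrier R; b \<in> carrier R; x \<in> carrier M\<rbrakk> \<Longrightarrow>
      (a \<otimes> b) \<odot>\<^bsub>M\<^esub> x = a \<odot>\<^bsub>M\<^esub> (b \<odot>\<^bsub>M\<^esub> x)"
    and "\<And>x. x \<in> carrier M \<Longrightarrow> \<one> \<odot>\<^bsub>M\<^esub> x = x"
  shows "left_module R M"
  using assms by (intro left_module.intro left_module_axioms.intro) auto

lemma left_module_homI:
  assumes "\<And>x. x \<in> carrier A \<Longrightarrow> f x \<in> carrier B"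
    and "\<And>x y. \<lbrakk>x \<in> carrier A; y \<in> carrier A\<rbrakk> \<Longrightarrow> f (x \<oplus>\<^bsub>A\<^esub> y) = f x \<oplus>\<^bsub>B\<^esub> f y"
    and "\<And>a x. \<lbrakk>a \<in> carrier R; x \<in> carrier A\<rbrakk> \<Longrightarrow> f (a \<odot>\<^bsub>A\<^esub> x) = a \<odot>\<^bsub>B\<^esub> f x"
  shows "f \<in> left_module_hom R A B"
  using assms unfolding left_module_hom_def by blast

lemma left_module_homD:
  assumes "f \<in> left_module_hom R A B"
  shows "\<And>x. x \<in> carrier A \<Longrightarrow> f x \<in> carrier B"
    and "\<And>x y. \<lbrakk>x \<in> carrier A; y \<in> carrier A\<rbrakk> \<Longrightarrow> f (x \<oplus>\<^bsub>A\<^esub> y) = f x \<oplus>\<^bsub>B\<^esub> f y"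
    and "\<And>a x. \<lbrakk>a \<in> carrier R; x \<in> carrier A\<rbrakk> \<Longrightarrow> f (a \<odot>\<^bsub>A\<^esub> x) = a \<odot>\<^bsub>B\<^esub> f x"
  using assms unfolding left_module_hom_def by blast+

lemma left_module_hom_compose:
  "\<lbrakk>f \<in> left_module_hom R A B; g \<in> left_module_hom R B C\<rbrakk> \<Longrightarrow> g \<circ> f \<in> left_module_hom R A C"
  unfolding left_module_hom_def by (auto simp: Pi_iff)

locale left_module_homomorphism = A?: left_module R A + B?: left_module R B
  for R :: "('r, 'k) ring_scheme" (structure)
    and A :: "('r, 'a, 'x) module_scheme" and B :: "('r, 'b, 'y) module_scheme" +
  fixes f :: "'a \<Rightarrow> 'b"
  assumes hom: "f \<in> left_module_hom R A B"
begin

lemmas hom_closed = left_module_homD(1)[OF hom]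
lemmas hom_add = left_module_homD(2)[OF hom]
lemmas hom_smult = left_module_homD(3)[OF hom]

lemma hom_zero: "f \<zero>\<^bsub>A\<^esub> = \<zero>\<^bsub>B\<^esub>"
  using hom_smult[of \<zero> "\<zero>\<^bsub>A\<^esub>"] hom_closed[of "\<zero>\<^bsub>A\<^esub>"]
  by (simp add: A.smult_l_null B.smult_l_null)

lemma hom_minus: "x \<in> carrier A \<Longrightarrow> f (\<ominus>\<^bsub>A\<^esub> x) = \<ominus>\<^bsub>B\<^esub> f x"
  by (metis A.M.a_inv_closed A.M.l_neg B.M.minus_equality hom_add hom_closed hom_zero)

lemma hom_diff:
  "\<lbrakk>x \<in> carrier A; y \<in> carrier A\<rbrakk> \<Longrightarrow> f (x \<ominus>\<^bsub>A\<^esub> y) = f x \<ominus>\<^bsub>B\<^esub> f y"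
  by (simp add: a_minus_def hom_add hom_minus)

lemma inj_on_iff_kernel:
  "inj_on f (carrier A) \<longleftrightarrow> (\<forall>x\<in>carrier A. f x = \<zero>\<^bsub>B\<^esub> \<longrightarrow> x = \<zero>\<^bsub>A\<^esub>)"
proof
  assume "inj_on f (carrier A)"
  then show "\<forall>x\<in>carrier A. f x = \<zero>\<^bsub>B\<^esub> \<longrightarrow> x = \<zero>\<^bsub>A\<^esub>"
    using hom_zero by (metis A.M.zero_closed inj_onD)
next
  assume *: "\<forall>x\<in>carrier A. f x = \<zero>\<^bsub>B\<^esub> \<longrightarrow> x = \<zero>\<^bsub>A\<^esub>"
  show "inj_on f (carrier A)"
  proof (rule inj_onI)
    fix x y assume xy: "x \<in> carrier A" "y \<in> carrier A" "f x = f y"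
    then have "f (x \<ominus>\<^bsub>A\<^esub> y) = \<zero>\<^bsub>B\<^esub>"
      by (simp add: hom_diff hom_closed B.M.minus_eq_zero_iff)
    then have "x \<ominus>\<^bsub>A\<^esub> y = \<zero>\<^bsub>A\<^esub>"
      using * A.M.minus_closed[OF xy(1,2)] by blast
    then show "x = y"
      using xy A.M.minus_eq_zero_iff by blast
  qed
qed

lemma image_submodule:
  assumes "submodule C R A" shows "submodule (f ` C) R B"
proof -
  note C = A.left_submoduleD[OF assms]
  show ?thesis
  proof (rule B.left_submoduleI)
    show "\<zero>\<^bsub>B\<^esub> \<in> f ` C"
      using hom_zero C(2) by (metis imageI)
    fix a x assume "a \<in> carrier R" "x \<in> f ` C"
    then show "a \<odot>\<^bsub>B\<^esub> x \<in> f ` C"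
      using C(3,7) by (auto simp flip: hom_smult)
  next
    fix x y assume "x \<in> f ` C" "y \<in> f ` C"
    then show "x \<oplus>\<^bsub>B\<^esub> y \<in> f ` C"
      using C(3,4) by (auto simp flip: hom_add)
  qed (use C in \<open>auto simp: hom_closed\<close>)
qed

end

text \<open>With \<open>R\<close> viewed as a left module over itself,
  \<open>submodule L R (regular_module R)\<close> says that \<open>L\<close> is a left
  ideal.\<close>

definition regular_module :: "('r, 'k) ring_scheme \<Rightarrow> ('r, 'r) module"
  where "regular_module R = \<lparr>carrier = carrier R, monoid.mult = monoid.mult R, one = one R,
    ring.zero = ring.zero R, ring.add = ring.add R, module.smult = monoid.mult R\<rparr>"

lemma regular_module_simps [simp]:
  "carrier (regular_module R) = carrier R" "ring.zero (regular_module R) = ring.zero R"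
  "ring.add (regular_module R) = ring.add R" "module.smult (regular_module R) = monoid.mult R"
  by (simp_all add: regular_module_def)

lemma left_module_regular:
  assumes "ring R" shows "left_module R (regular_module R)"
proof -
  interpret ring R by fact
  show ?thesis
  proof (rule left_moduleI)
    show "abelian_group (regular_module R)"
      by (rule abelian_groupI) (auto simp: a_ac intro: bexI[of _ "\<ominus>\<^bsub>R\<^esub> _"] l_neg)
  qed (auto simp: assms l_distr r_distr m_assoc)
qed

text \<open>The quotient module if the fibres of \<open>q\<close> are the cosets of a submodule, a copy of \<open>N\<close> if \<open>q\<close> is
  injective.\<close>

definition image_module :: "('r, 'n, 'x) module_scheme \<Rightarrow> ('n \<Rightarrow> 'q) \<Rightarrow> ('r, 'q) module"
  where "image_module N q = (let rep = inv_into (carrier N) q in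
    \<lparr>carrier = q ` carrier N, monoid.mult = undefined, one = undefined, ring.zero = q \<zero>\<^bsub>N\<^esub>,
     ring.add = (\<lambda>u v. q (rep u \<oplus>\<^bsub>N\<^esub> rep v)), module.smult = (\<lambda>a u. q (a \<odot>\<^bsub>N\<^esub> rep u))\<rparr>)"

lemma image_module:
  fixes N :: "('r, 'n, 'x) module_scheme" and q :: "'n \<Rightarrow> 'q"
  assumes "left_module R N" "submodule K R N"
    and fibres: "\<And>x y. \<lbrakk>x \<in> carrier N; y \<in> carrier N\<rbrakk> \<Longrightarrow> q x = q y \<longleftrightarrow> x \<ominus>\<^bsub>N\<^esub> y \<in> K"
  shows "left_module R (image_module N q)" "q \<in> left_module_hom R N (image_module N q)"
    "carrier (image_module N q) = q ` carrier N" "\<zero>\<^bsub>image_module N q\<^esub> = q \<zero>\<^bsub>N\<^esub>"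
proof -
  interpret N: left_module R N by fact
  note K = N.left_submoduleD[OF assms(2)]
  let ?Q = "image_module N q"
  show carrier: "carrier ?Q = q ` carrier N" and zero: "\<zero>\<^bsub>?Q\<^esub> = q \<zero>\<^bsub>N\<^esub>"
    by (simp_all add: image_module_def Let_def)
  define rep where "rep = inv_into (carrier N) q"
  have rep: "rep (q x) \<in> carrier N" "q (rep (q x)) = q x" "rep (q x) \<ominus>\<^bsub>N\<^esub> x \<in> K"
    if "x \<in> carrier N" for x
    using that fibres[of "rep (q x)" x]
    by (auto simp: rep_def inv_into_into f_inv_into_f)
  \<comment> \<open>The chosen representatives may be exchanged for x and y, since the two sums
    differ by an element of K.\<close>
  have add: "q x \<oplus>\<^bsub>?Q\<^esub> q y = q (x \<oplus>\<^bsub>N\<^esub> y)" if "x \<in> carrier N" "y \<in> carrier N" for x y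
  proof -
    have "(rep (q x) \<oplus>\<^bsub>N\<^esub> rep (q y)) \<ominus>\<^bsub>N\<^esub> (x \<oplus>\<^bsub>N\<^esub> y)
        = (rep (q x) \<ominus>\<^bsub>N\<^esub> x) \<oplus>\<^bsub>N\<^esub> (rep (q y) \<ominus>\<^bsub>N\<^esub> y)"
      using that rep(1) by (simp add: a_minus_def N.M.minus_add N.M.a_ac)
    also have "\<dots> \<in> K"
      using that rep(3) by (intro K(4))
    finally show ?thesis
      using that fibres rep(1) by (simp add: image_module_def Let_def rep_def)
  qed
  have smult: "a \<odot>\<^bsub>?Q\<^esub> q x = q (a \<odot>\<^bsub>N\<^esub> x)" if "a \<in> carrier R" "x \<in> carrier N" for a x
  proof -
    have "a \<odot>\<^bsub>N\<^esub> rep (q x) \<ominus>\<^bsub>N\<^esub> a \<odot>\<^bsub>N\<^esub> x \<in> K"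
      using that rep K(7) by (simp flip: N.smult_r_diff)
    then show ?thesis
      using that fibres rep(1) N.smult_closed by (simp add: image_module_def Let_def rep_def)
  qed
  show "q \<in> left_module_hom R N ?Q"
    by (rule left_module_homI) (auto simp: carrier add smult)
  have "abelian_group ?Q"
  proof (rule abelian_groupI)
    fix u assume "u \<in> carrier ?Q"
    then obtain x where "x \<in> carrier N" "u = q x"
      by (auto simp: carrier)
    then show "\<exists>y\<in>carrier ?Q. y \<oplus>\<^bsub>?Q\<^esub> u = \<zero>\<^bsub>?Q\<^esub>"
      by (intro bexI[of _ "q (\<ominus>\<^bsub>N\<^esub> x)"]) (auto simp: carrier zero add N.M.l_neg)
  qed (auto simp: carrier zero add N.M.a_ac)
  then show "left_module R ?Q"
    by (intro left_moduleI)
      (auto simp: carrier smult add N.R.ring_axioms N.smult_closed N.smult_l_distr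
        N.smult_r_distr N.smult_assoc1 N.smult_one)
qed

lemma quotient_module:
  fixes N :: "('r, 'n, 'x) module_scheme"
  assumes "left_module R N" "submodule K R N"
  obtains Q :: "('r, 'n set) module" and q
  where "left_module R Q" "q \<in> left_module_hom R N Q" "carrier Q = q ` carrier N"
    "\<And>x. x \<in> carrier N \<Longrightarrow> q x = \<zero>\<^bsub>Q\<^esub> \<longleftrightarrow> x \<in> K"
proof -
  interpret N: left_module R N by fact
  note K = N.left_submoduleD[OF assms(2)]
  define q where "q x = {y \<in> carrier N. y \<ominus>\<^bsub>N\<^esub> x \<in> K}" for x
  have sub: "z \<ominus>\<^bsub>N\<^esub> y \<in> K" if "x \<ominus>\<^bsub>N\<^esub> y \<in> K" "z \<ominus>\<^bsub>N\<^esub> x \<in> K"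
    "x \<in> carrier N" "y \<in> carrier N" "z \<in> carrier N" for x y z
  proof -
    have "z \<ominus>\<^bsub>N\<^esub> y = (z \<ominus>\<^bsub>N\<^esub> x) \<oplus>\<^bsub>N\<^esub> (x \<ominus>\<^bsub>N\<^esub> y)"
      using that by (simp add: a_minus_def N.M.a_assoc N.M.l_neg N.M.r_neg1)
    then show ?thesis
      using that K by simp
  qed
  have sym: "y \<ominus>\<^bsub>N\<^esub> x \<in> K" if "x \<ominus>\<^bsub>N\<^esub> y \<in> K" "x \<in> carrier N" "y \<in> carrier N" for x y
    using K(5)[OF that(1)] that by (simp add: a_minus_def N.M.minus_add N.M.a_comm)
  have fibres: "q x = q y \<longleftrightarrow> x \<ominus>\<^bsub>N\<^esub> y \<in> K" if xy: "x \<in> carrier N" "y \<in> carrier N" for x y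
  proof
    assume "q x = q y"
    moreover have "x \<in> q x"
      using xy K(2) N.M.minus_eq_zero_iff[of x x] by (simp add: q_def)
    ultimately show "x \<ominus>\<^bsub>N\<^esub> y \<in> K"
      by (simp add: q_def)
  next
    assume "x \<ominus>\<^bsub>N\<^esub> y \<in> K"
    then show "q x = q y"
      using xy sub sym unfolding q_def by blast
  qed
  note Q = image_module[OF assms fibres]
  show thesis
    by (rule that[OF Q(1-3)]) (use fibres in \<open>auto simp: Q(4) a_minus_def N.M.a_inv_zero\<close>)
qed

lemma copy_module:
  fixes N :: "('r, 'n, 'x) module_scheme" and e :: "'n \<Rightarrow> 'q"
  assumes "left_module R N" "inj_on e (carrier N)"
  shows "left_module R (image_module N e)" "e \<in> left_module_hom R N (image_module N e)"
    "carrier (image_module N e) = e ` carrier N"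
proof -
  interpret N: left_module R N by fact
  have "e x = e y \<longleftrightarrow> x \<ominus>\<^bsub>N\<^esub> y \<in> {\<zero>\<^bsub>N\<^esub>}" if "x \<in> carrier N" "y \<in> carrier N" for x y
    using that assms(2) by (simp add: N.M.minus_eq_zero_iff inj_on_eq_iff)
  note * = image_module[OF assms(1) N.left_submodule_zero this]
  show "left_module R (image_module N e)" "e \<in> left_module_hom R N (image_module N e)"
    "carrier (image_module N e) = e ` carrier N"
    by (rule *; assumption)+
qed

section \<open>Ideal filters and completeness\<close>

locale filtered_ring = ring R for R :: "('r, 'k) ring_scheme" (structure) +
  fixes J :: "'r set set"
  assumes filter: "ideal_filter R J"
begin

lemma filter_right_ideal: "I \<in> J \<Longrightarrow> right_ideal I R"
  using filter unfolding ideal_filter_def by blast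

lemma filter_carrier: "\<lbrakk>I \<in> J; a \<in> I\<rbrakk> \<Longrightarrow> a \<in> carrier R"
  using right_ideal.axioms(1)[OF filter_right_ideal] additive_subgroup.a_Hcarr by metis

lemma filter_r_closed: "\<lbrakk>I \<in> J; a \<in> I; b \<in> carrier R\<rbrakk> \<Longrightarrow> a \<otimes> b \<in> I"
  using filter_right_ideal right_ideal.I_r_closed by metis

lemma filter_Int: "\<lbrakk>I \<in> J; K \<in> J\<rbrakk> \<Longrightarrow> I \<inter> K \<in> J"
  using filter unfolding ideal_filter_def by blast

lemma filter_nonempty: obtains I where "I \<in> J"
  using filter unfolding ideal_filter_def by blast

lemma colon_iff:
  "x \<in> colon J B A \<longleftrightarrow> x \<in> carrier B \<and> (\<exists>I\<in>J. \<forall>a\<in>I. a \<odot>\<^bsub>B\<^esub> x \<in> A)"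
  unfolding colon_def image_subset_iff by simp

lemma torsion_iff:
  "x \<in> torsion J B \<longleftrightarrow> x \<in> carrier B \<and> (\<exists>I\<in>J. \<forall>a\<in>I. a \<odot>\<^bsub>B\<^esub> x = \<zero>\<^bsub>B\<^esub>)"
  by (simp add: torsion_def colon_iff)

lemma colon_mono: "A \<subseteq> A' \<Longrightarrow> colon J B A \<subseteq> colon J B A'"
  unfolding colon_def by blast

lemma colon_superset:
  assumes "left_module R B" "submodule A R B" shows "A \<subseteq> colon J B A"
proof
  fix x assume x: "x \<in> A"
  obtain I where "I \<in> J"
    by (rule filter_nonempty)
  then show "x \<in> colon J B A"
    using x left_module.left_submoduleD(3,7)[OF assms] filter_carrier by (auto simp: colon_iff)
qed

text \<open>As \<open>I\<close> is a right ideal, \<open>I x \<subseteq> A\<close> implies \<open>I (r x) \<subseteq> A\<close>.\<close>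

lemma colon_submodule:
  assumes "left_module R B" "submodule A R B" shows "submodule (colon J B A) R B"
proof -
  interpret B: left_module R B by fact
  note A = B.left_submoduleD[OF assms(2)]
  show ?thesis
  proof (rule B.left_submoduleI)
    fix x y assume "x \<in> colon J B A" "y \<in> colon J B A"
    then obtain I K where "x \<in> carrier B" "y \<in> carrier B" and IK: "I \<in> J" "K \<in> J"
      "\<forall>a\<in>I. a \<odot>\<^bsub>B\<^esub> x \<in> A" "\<forall>a\<in>K. a \<odot>\<^bsub>B\<^esub> y \<in> A"
      by (auto simp: colon_iff)
    moreover from this have "\<forall>a\<in>I \<inter> K. a \<odot>\<^bsub>B\<^esub> (x \<oplus>\<^bsub>B\<^esub> y) \<in> A"
      using A filter_carrier by (auto simp: B.smult_r_distr)
    ultimately show "x \<oplus>\<^bsub>B\<^esub> y \<in> colon J B A"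
      using filter_Int by (auto simp: colon_iff)
  next
    fix r x assume r: "r \<in> carrier R" and "x \<in> colon J B A"
    then obtain I where x: "x \<in> carrier B" "I \<in> J" "\<forall>a\<in>I. a \<odot>\<^bsub>B\<^esub> x \<in> A"
      by (auto simp: colon_iff)
    then have "\<forall>a\<in>I. a \<odot>\<^bsub>B\<^esub> (r \<odot>\<^bsub>B\<^esub> x) \<in> A"
      using r filter_carrier filter_r_closed by (metis B.smult_assoc1)
    then show "r \<odot>\<^bsub>B\<^esub> x \<in> colon J B A"
      using x r by (auto simp: colon_iff B.smult_closed)
  next
    show "\<zero>\<^bsub>B\<^esub> \<in> colon J B A"
      using A(2) colon_superset[OF assms] by blast
  qed (auto simp: colon_iff)
qed

lemma torsion_submodule: "left_module R B \<Longrightarrow> submodule (torsion J B) R B"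
  unfolding torsion_def by (intro colon_submodule left_module.left_submodule_zero)

end

text \<open>Completeness is applied to a copy of \<open>R\<close> on the type \<open>'b\<close>, to
  the copy of \<open>L\<close> and to the element 1: the assumption puts \<open>I 1\<close> into
  \<open>(L : J)\<close>, so 1 lies in \<open>((L : J) : J) = (L : J)\<close>, and
  \<open>K 1 \<subseteq> L\<close> means \<open>K \<subseteq> L\<close>. The embedding
  \<open>e\<close> is what ties the fixed type of the hypothesis to \<open>R\<close>.\<close>

lemma complete_filter_left_ideal:
  fixes e :: "'r \<Rightarrow> 'b"
  assumes "filtered_ring R J" "complete_filter TYPE('b) R J" "inj_on e (carrier R)"
    and L: "submodule L R (regular_module R)"
    and I: "I \<in> J" "\<And>a. a \<in> I \<Longrightarrow> \<exists>K\<in>J. \<forall>k\<in>K. k \<otimes>\<^bsub>R\<^esub> a \<in> L"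
  shows "\<exists>K\<in>J. K \<subseteq> L"
proof -
  interpret filtered_ring R J by fact
  have reg: "left_module R (regular_module R)"
    by (rule left_module_regular) (rule ring_axioms)
  define B where "B = image_module (regular_module R) e"
  have B: "left_module R B" "e \<in> left_module_hom R (regular_module R) B" "carrier B = e ` carrier R"
    using copy_module[OF reg, of e] assms(3) by (simp_all add: B_def)
  interpret e: left_module_homomorphism R "regular_module R" B e
    using reg B by (simp add: left_module_homomorphism_def left_module_homomorphism_axioms_def)
  have smult: "a \<odot>\<^bsub>B\<^esub> e b = e (a \<otimes>\<^bsub>R\<^esub> b)" if "a \<in> carrier R" "b \<in> carrier R" for a b
    using e.hom_smult[of a b] that by simp
  have "e a \<in> colon J B (e ` L)" if "a \<in> I" for a
  proof -
    have a: "a \<in> carrier R"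
      using filter_carrier I(1) that .
    obtain K where K: "K \<in> J" "\<forall>k\<in>K. k \<otimes>\<^bsub>R\<^esub> a \<in> L"
      using I(2) \<open>a \<in> I\<close> by blast
    then have "\<forall>k\<in>K. k \<odot>\<^bsub>B\<^esub> e a \<in> e ` L"
      using a filter_carrier[OF K(1)] by (auto simp: smult)
    then show ?thesis
      using a K(1) by (auto simp: colon_iff B(3))
  qed
  then have "a \<odot>\<^bsub>B\<^esub> e \<one>\<^bsub>R\<^esub> \<in> colon J B (e ` L)" if "a \<in> I" for a
    using that filter_carrier[OF I(1) that] by (simp add: smult)
  then have "e \<one>\<^bsub>R\<^esub> \<in> colon J B (colon J B (e ` L))"
    using I(1) B(3) by (subst colon_iff) auto
  also have "\<dots> = colon J B (e ` L)"
    using assms(2) B(1) e.image_submodule[OF L] unfolding complete_filter_def by blast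
  finally obtain K where K: "K \<in> J" "\<forall>k\<in>K. k \<odot>\<^bsub>B\<^esub> e \<one>\<^bsub>R\<^esub> \<in> e ` L"
    by (auto simp: colon_iff)
  have "k \<in> L" if "k \<in> K" for k
  proof -
    have k: "k \<in> carrier R"
      using filter_carrier K(1) that by blast
    then have "e k \<in> e ` L"
      using bspec[OF K(2) that] by (simp add: smult)
    moreover have "L \<subseteq> carrier R"
      using left_module.left_submoduleD(1)[OF reg L] by simp
    ultimately show ?thesis
      using k assms(3) by (meson inj_on_image_mem_iff)
  qed
  then show ?thesis
    using K(1) by blast
qed

text \<open>Completeness in the form of a transitivity property of left ideals, free of any type of
  modules.\<close>

locale complete_filtered_ring = filtered_ring R J
  for R :: "('r, 'k) ring_scheme" (structure) and J +
  assumes complete: "\<lbrakk>submodule L R (regular_module R); I \<in> J;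
      \<And>a. a \<in> I \<Longrightarrow> \<exists>K\<in>J. \<forall>k\<in>K. k \<otimes> a \<in> L\<rbrakk> \<Longrightarrow> \<exists>K\<in>J. K \<subseteq> L"
begin

text \<open>The way back to modules on an arbitrary type: for x in the double colon, the left ideal
  of all r with \<open>r x \<in> A\<close> satisfies the premises of \<open>complete\<close>, and a
  member of \<open>J\<close> inside it witnesses that x lies in the colon.\<close>

lemma colon_colon:
  assumes "left_module R B" "submodule A R B"
  shows "colon J B (colon J B A) = colon J B A"
proof
  interpret B: left_module R B by fact
  note A = B.left_submoduleD[OF assms(2)]
  show "colon J B A \<subseteq> colon J B (colon J B A)"
    using colon_superset[OF assms(1) colon_submodule[OF assms]] .
  show "colon J B (colon J B A) \<subseteq> colon J B A"
  proof
    fix x assume "x \<in> colon J B (colon J B A)"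
    then obtain I where x: "x \<in> carrier B" and I: "I \<in> J" "\<forall>a\<in>I. a \<odot>\<^bsub>B\<^esub> x \<in> colon J B A"
      by (auto simp: colon_iff[of _ _ "colon J B A"])
    have sub: "submodule {r \<in> carrier R. r \<odot>\<^bsub>B\<^esub> x \<in> A} R (regular_module R)"
      using A x
      by (intro left_module.left_submoduleI[OF left_module_regular[OF ring_axioms]])
        (auto simp: B.smult_l_null B.smult_l_distr B.smult_assoc1)
    have "\<exists>K\<in>J. \<forall>k\<in>K. k \<otimes> a \<in> {r \<in> carrier R. r \<odot>\<^bsub>B\<^esub> x \<in> A}" if a: "a \<in> I" for a
    proof -
      obtain K where K: "K \<in> J" "\<forall>k\<in>K. k \<odot>\<^bsub>B\<^esub> (a \<odot>\<^bsub>B\<^esub> x) \<in> A"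
        using I a by (auto simp: colon_iff)
      moreover have "a \<in> carrier R"
        using filter_carrier I(1) a .
      ultimately show ?thesis
        using x filter_carrier by (intro bexI[of _ K]) (auto simp: B.smult_assoc1)
    qed
    then obtain K where "K \<in> J" "K \<subseteq> {r \<in> carrier R. r \<odot>\<^bsub>B\<^esub> x \<in> A}"
      using complete[OF sub I(1)] by blast
    then show "x \<in> colon J B A"
      using x by (auto simp: colon_iff)
  qed
qed

end

section \<open>Baer's criterion\<close>

text \<open>The equation \<open>f l = l q\<close> says that f extends to all of \<open>R\<close>,
  with q the value at 1. The condition \<open>I \<subseteq> L\<close> is the one under which the
  inclusion of \<open>L\<close> in \<open>R\<close> is a \<open>J\<close>-extension.\<close>

definition baer :: "('r, 'k) ring_scheme \<Rightarrow> 'r set set \<Rightarrow> ('r, 'q, 'z) module_scheme \<Rightarrow> bool"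
  where "baer R J Q \<longleftrightarrow> (\<forall>L f. submodule L R (regular_module R) \<and> (\<exists>I\<in>J. I \<subseteq> L) \<and>
    f \<in> left_module_hom R (regular_module R\<lparr>carrier := L\<rparr>) Q \<longrightarrow>
    (\<exists>q\<in>carrier Q. \<forall>l\<in>L. f l = l \<odot>\<^bsub>Q\<^esub> q))"

text \<open>The inclusion of \<open>L\<close> in \<open>R\<close> is copied to the type
  \<open>'b\<close>, where injectivity is assumed; the extended map, evaluated at the copy of 1,
  gives q.\<close>

lemma J_injective_imp_baer:
  fixes e :: "'r \<Rightarrow> 'b"
  assumes "filtered_ring R J" "J_injective TYPE('b) TYPE('b) R J Q" "inj_on e (carrier R)"
  shows "baer R J Q"
  unfolding baer_def
proof (intro allI impI, elim conjE bexE)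
  fix L f I
  assume L: "submodule L R (regular_module R)" and I: "I \<in> J" "I \<subseteq> L"
    and f: "f \<in> left_module_hom R (regular_module R\<lparr>carrier := L\<rparr>) Q"
  interpret filtered_ring R J by fact
  have reg: "left_module R (regular_module R)"
    by (rule left_module_regular) (rule ring_axioms)
  have LR: "L \<subseteq> carrier R"
    using left_module.left_submoduleD(1)[OF reg L] by simp
  define B where "B = image_module (regular_module R) e"
  have B: "left_module R B" "e \<in> left_module_hom R (regular_module R) B" "carrier B = e ` carrier R"
    using copy_module[OF reg, of e] assms(3) by (simp_all add: B_def)
  interpret e: left_module_homomorphism R "regular_module R" B e
    using reg B by (simp add: left_module_homomorphism_def left_module_homomorphism_axioms_def)
  define A where "A = B\<lparr>carrier := e ` L\<rparr>"
  have A: "left_module R A"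
    unfolding A_def by (intro left_module.left_module_submodule B e.image_submodule L)
  have smult: "a \<odot>\<^bsub>B\<^esub> e b = e (a \<otimes>\<^bsub>R\<^esub> b)" if "a \<in> carrier R" "b \<in> carrier R" for a b
    using e.hom_smult[of a b] that by simp
  have add: "e a \<oplus>\<^bsub>B\<^esub> e b = e (a \<oplus>\<^bsub>R\<^esub> b)" if "a \<in> carrier R" "b \<in> carrier R" for a b
    using e.hom_add[of a b] that by simp
  have "colon J B (e ` L) = carrier B"
  proof
    \<comment> \<open>The same I serves every r: as a right ideal it satisfies
      \<open>I r \<subseteq> I \<subseteq> L\<close>.\<close>
    show "carrier B \<subseteq> colon J B (e ` L)"
    proof
      fix x assume "x \<in> carrier B"
      then obtain r where "r \<in> carrier R" "x = e r"
        by (auto simp: B(3))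
      moreover from this have "\<forall>a\<in>I. a \<odot>\<^bsub>B\<^esub> e r \<in> e ` L"
        using I(2) filter_r_closed[OF I(1)] filter_carrier[OF I(1)] by (auto simp: smult subset_eq)
      ultimately show "x \<in> colon J B (e ` L)"
        using I(1) by (auto simp: colon_iff B(3))
    qed
  qed (auto simp: colon_iff)
  then have ext: "J_extension R J A B (\<lambda>x. x)"
    using A B(1) LR unfolding J_extension_def by (auto simp: A_def left_module_hom_def B(3))
  define f' where "f' = f \<circ> inv_into (carrier R) e"
  have f'e: "f' (e r) = f r" if "r \<in> L" for r
    using that LR assms(3) by (auto simp: f'_def inv_into_f_f)
  have "f' \<in> left_module_hom R A Q"
  proof (rule left_module_homI)
    fix x y assume "x \<in> carrier A" "y \<in> carrier A"
    then obtain r t where rt: "r \<in> L" "t \<in> L" "x = e r" "y = e t"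
      by (auto simp: A_def)
    moreover have "r \<oplus>\<^bsub>R\<^esub> t \<in> L"
      using rt left_module.left_submoduleD(4)[OF reg L] by simp
    moreover have "f (r \<oplus>\<^bsub>R\<^esub> t) = f r \<oplus>\<^bsub>Q\<^esub> f t"
      using left_module_homD(2)[OF f] rt by simp
    ultimately show "f' (x \<oplus>\<^bsub>A\<^esub> y) = f' x \<oplus>\<^bsub>Q\<^esub> f' y"
      using LR f'e by (auto simp: A_def add subset_eq)
  next
    fix a x assume a: "a \<in> carrier R" and "x \<in> carrier A"
    then obtain r where r: "r \<in> L" "x = e r"
      by (auto simp: A_def)
    moreover have "a \<otimes>\<^bsub>R\<^esub> r \<in> L"
      using a r left_module.left_submoduleD(7)[OF reg L] by simp
    moreover have "f (a \<otimes>\<^bsub>R\<^esub> r) = a \<odot>\<^bsub>Q\<^esub> f r"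
      using left_module_homD(3)[OF f] a r by simp
    ultimately show "f' (a \<odot>\<^bsub>A\<^esub> x) = a \<odot>\<^bsub>Q\<^esub> f' x"
      using LR f'e a by (auto simp: A_def smult subset_eq)
  qed (use left_module_homD(1)[OF f] in \<open>auto simp: A_def f'e\<close>)
  then obtain g where g: "g \<in> left_module_hom R B Q" "\<And>x. x \<in> carrier A \<Longrightarrow> f' x = g x"
    using assms(2) ext unfolding J_injective_def by blast
  have "f l = l \<odot>\<^bsub>Q\<^esub> g (e \<one>\<^bsub>R\<^esub>)" if "l \<in> L" for l
  proof -
    have l: "l \<in> carrier R"
      using that LR by auto
    have "f l = g (e l)"
      using that g(2)[of "e l"] by (simp add: A_def f'e)
    also have "e l = l \<odot>\<^bsub>B\<^esub> e \<one>\<^bsub>R\<^esub>"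
      using l by (simp add: smult)
    finally show ?thesis
      using left_module_homD(3)[OF g(1) l] B(3) by simp
  qed
  moreover have "g (e \<one>\<^bsub>R\<^esub>) \<in> carrier Q"
    using left_module_homD(1)[OF g(1)] B(3) by simp
  ultimately show "\<exists>q\<in>carrier Q. \<forall>l\<in>L. f l = l \<odot>\<^bsub>Q\<^esub> q"
    by blast
qed

text \<open>Baer's argument: by Zorn's lemma there is a maximal partial homomorphism extending f,
  and any x can be added to its domain. The colon condition ensures that the left ideal of scalars
  moving x into that domain contains a member of \<open>J\<close>, so that \<open>baer\<close>
  applies to it.\<close>

lemma (in filtered_ring) baer_extend:
  fixes B :: "('r, 'b, 'y) module_scheme" and Q :: "('r, 'q, 'z) module_scheme"
  assumes "baer R J Q" "left_module R Q" "left_module R B" "submodule A R B"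
    and colon: "carrier B \<subseteq> colon J B A"
    and f: "f \<in> left_module_hom R (B\<lparr>carrier := A\<rparr>) Q"
  obtains g where "g \<in> left_module_hom R B Q" "\<And>x. x \<in> A \<Longrightarrow> g x = f x"
proof -
  interpret Q: left_module R Q by fact
  interpret B: left_module R B by fact
  note A = B.left_submoduleD[OF assms(4)]
  \<comment> \<open>Partial homomorphisms are represented by their graphs, so that the union of a
    chain is an upper bound. Negatives come from the scalar -1.\<close>
  define partial where "partial G \<longleftrightarrow> G \<subseteq> carrier B \<times> carrier Q \<and> (\<lambda>x. (x, f x)) ` A \<subseteq> G \<and>
    (\<forall>x u y v. (x, u) \<in> G \<and> (y, v) \<in> G \<longrightarrow> (x \<oplus>\<^bsub>B\<^esub> y, u \<oplus>\<^bsub>Q\<^esub> v) \<in> G) \<and>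
    (\<forall>a x u. a \<in> carrier R \<and> (x, u) \<in> G \<longrightarrow> (a \<odot>\<^bsub>B\<^esub> x, a \<odot>\<^bsub>Q\<^esub> u) \<in> G) \<and>
    (\<forall>x u v. (x, u) \<in> G \<and> (x, v) \<in> G \<longrightarrow> u = v)" for G
  have "partial ((\<lambda>x. (x, f x)) ` A)"
    using A left_module_homD[OF f] by (auto simp: partial_def)
  moreover have "partial (\<Union>C)" if C: "C \<noteq> {}" "subset.chain {G. partial G} C" for C
  proof -
    have p: "partial G" if "G \<in> C" for G
      using C(2) that by (auto simp: subset_chain_def)
    have two: "\<exists>G\<in>C. p \<in> G \<and> p' \<in> G" if "p \<in> \<Union>C" "p' \<in> \<Union>C" for p p'
      using C(2) that unfolding subset_chain_def by blast
    show ?thesis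
      unfolding partial_def
    proof (intro conjI allI impI)
      show "(\<lambda>x. (x, f x)) ` A \<subseteq> \<Union>C"
        using C(1) p unfolding partial_def by blast
      fix x u y v assume "(x, u) \<in> \<Union>C \<and> (y, v) \<in> \<Union>C"
      then obtain G where "G \<in> C" "(x, u) \<in> G" "(y, v) \<in> G"
        using two by blast
      then show "(x \<oplus>\<^bsub>B\<^esub> y, u \<oplus>\<^bsub>Q\<^esub> v) \<in> \<Union>C"
        using p unfolding partial_def by blast
    next
      fix x u v assume "(x, u) \<in> \<Union>C \<and> (x, v) \<in> \<Union>C"
      then obtain G where "G \<in> C" "(x, u) \<in> G" "(x, v) \<in> G"
        using two by blast
      then show "u = v"
        using p unfolding partial_def by blast
    qed (use p in \<open>unfold partial_def, blast+\<close>)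
  qed
  ultimately obtain G where G: "partial G" and
    max: "\<And>G'. \<lbrakk>partial G'; G \<subseteq> G'\<rbrakk> \<Longrightarrow> G' = G"
    using subset_Zorn_nonempty[of "{G. partial G}"] by (metis empty_iff mem_Collect_eq)
  note G' = G[unfolded partial_def]
  have G_carrier: "x \<in> carrier B" "u \<in> carrier Q" if "(x, u) \<in> G" for x u
    using G'[THEN conjunct1] that by blast+
  have G_f: "(x, f x) \<in> G" if "x \<in> A" for x
    using G'[THEN conjunct2, THEN conjunct1] that by blast
  have G_add: "(x \<oplus>\<^bsub>B\<^esub> y, u \<oplus>\<^bsub>Q\<^esub> v) \<in> G" if "(x, u) \<in> G" "(y, v) \<in> G" for x u y v
    using G'[THEN conjunct2, THEN conjunct2, THEN conjunct1] that by blast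
  have G_smult: "(a \<odot>\<^bsub>B\<^esub> x, a \<odot>\<^bsub>Q\<^esub> u) \<in> G" if "a \<in> carrier R" "(x, u) \<in> G" for a x u
    using G'[THEN conjunct2, THEN conjunct2, THEN conjunct2, THEN conjunct1] that by blast
  have G_unique: "u = v" if "(x, u) \<in> G" "(x, v) \<in> G" for x u v
    using G'[THEN conjunct2, THEN conjunct2, THEN conjunct2, THEN conjunct2] that by blast
  have zero: "(\<zero>\<^bsub>B\<^esub>, \<zero>\<^bsub>Q\<^esub>) \<in> G"
    using G_smult[OF zero_closed G_f[OF A(2)]] G_carrier[OF G_f[OF A(2)]]
    by (simp add: B.smult_l_null Q.smult_l_null)
  have G_minus: "(x \<ominus>\<^bsub>B\<^esub> y, u \<ominus>\<^bsub>Q\<^esub> v) \<in> G" if xy: "(x, u) \<in> G" "(y, v) \<in> G" for x u y v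
    using G_add[OF xy(1) G_smult[OF _ xy(2), of "\<ominus> \<one>"]] G_carrier[OF xy(2)]
    by (simp add: a_minus_def B.smult_l_minus Q.smult_l_minus B.smult_one Q.smult_one)
  have total: "\<exists>u. (x, u) \<in> G" if x: "x \<in> carrier B" for x
  proof -
    \<comment> \<open>The graph G determines a homomorphism r |-> G(r x) on this left ideal. If x is
      to be added to the domain, its value q must satisfy \<open>r q = G(r x)\<close> there, which
      is exactly what \<open>baer\<close> provides.\<close>
    define L where "L = {r \<in> carrier R. \<exists>u. (r \<odot>\<^bsub>B\<^esub> x, u) \<in> G}"
    define h where "h r = (THE u. (r \<odot>\<^bsub>B\<^esub> x, u) \<in> G)" for r
    have h: "(r \<odot>\<^bsub>B\<^esub> x, h r) \<in> G" if "r \<in> L" for r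
      unfolding h_def using that G_unique by (auto simp: L_def intro: theI)
    have h_eq: "h r = u" if "(r \<odot>\<^bsub>B\<^esub> x, u) \<in> G" for r u
      unfolding h_def using that G_unique by blast
    have L: "submodule L R (regular_module R)"
    proof (rule left_module.left_submoduleI[OF left_module_regular[OF ring_axioms]])
      fix r r' assume "r \<in> L" "r' \<in> L"
      then show "r \<oplus>\<^bsub>regular_module R\<^esub> r' \<in> L"
        using G_add x by (fastforce simp: L_def B.smult_l_distr)
    next
      fix a r assume "a \<in> carrier R" "r \<in> L"
      then show "a \<odot>\<^bsub>regular_module R\<^esub> r \<in> L"
        using G_smult x by (fastforce simp: L_def B.smult_assoc1)
    qed (use zero x in \<open>auto simp: L_def B.smult_l_null\<close>)
    obtain I where I_J: "I \<in> J" "\<forall>a\<in>I. a \<odot>\<^bsub>B\<^esub> x \<in> A"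
      using subsetD[OF colon x] by (auto simp: colon_iff)
    then have I: "\<exists>I\<in>J. I \<subseteq> L"
      using filter_carrier[OF I_J(1)] G_f I_J by (intro bexI[of _ I]) (auto simp: L_def)
    have hom: "h \<in> left_module_hom R (regular_module R\<lparr>carrier := L\<rparr>) Q"
    proof (rule left_module_homI)
      fix r r' assume "r \<in> carrier (regular_module R\<lparr>carrier := L\<rparr>)"
        "r' \<in> carrier (regular_module R\<lparr>carrier := L\<rparr>)"
      then show "h (r \<oplus>\<^bsub>regular_module R\<lparr>carrier := L\<rparr>\<^esub> r') = h r \<oplus>\<^bsub>Q\<^esub> h r'"
        using G_add[OF h h] x by (intro h_eq) (auto simp: L_def B.smult_l_distr)
    next
      fix a r assume "a \<in> carrier R" "r \<in> carrier (regular_module R\<lparr>carrier := L\<rparr>)"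
      then show "h (a \<odot>\<^bsub>regular_module R\<lparr>carrier := L\<rparr>\<^esub> r) = a \<odot>\<^bsub>Q\<^esub> h r"
        using G_smult[OF _ h] x by (intro h_eq) (auto simp: L_def B.smult_assoc1)
    qed (use G_carrier(2)[OF h] in auto)
    obtain q where q: "q \<in> carrier Q" "\<And>l. l \<in> L \<Longrightarrow> h l = l \<odot>\<^bsub>Q\<^esub> q"
      using assms(1) L I hom unfolding baer_def by blast
    have hq: "u = r \<odot>\<^bsub>Q\<^esub> q" if "r \<in> carrier R" "(r \<odot>\<^bsub>B\<^esub> x, u) \<in> G" for r u
      using that h_eq q(2)[of r] by (auto simp: L_def)
    define G' where
      "G' = {(y \<oplus>\<^bsub>B\<^esub> r \<odot>\<^bsub>B\<^esub> x, u \<oplus>\<^bsub>Q\<^esub> r \<odot>\<^bsub>Q\<^esub> q) | y u r. (y, u) \<in> G \<and> r \<in> carrier R}"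
    have sub: "G \<subseteq> G'"
    proof (rule subrelI)
      fix y u assume yu: "(y, u) \<in> G"
      then show "(y, u) \<in> G'"
        unfolding G'_def using x q(1) G_carrier[OF yu]
        by (intro CollectI exI[of _ y] exI[of _ u] exI[of _ \<zero>])
          (simp add: B.smult_l_null Q.smult_l_null)
    qed
    have "partial G'"
      unfolding partial_def
    proof (intro conjI allI impI)
      show "G' \<subseteq> carrier B \<times> carrier Q"
        using G_carrier x q(1) by (auto simp: G'_def B.smult_closed Q.smult_closed)
      show "(\<lambda>x. (x, f x)) ` A \<subseteq> G'"
        using sub G_f by auto
    next
      fix y u z v assume "(y, u) \<in> G' \<and> (z, v) \<in> G'"
      then obtain y1 u1 r1 y2 u2 r2 where *: "(y1, u1) \<in> G" "(y2, u2) \<in> G"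
        "r1 \<in> carrier R" "r2 \<in> carrier R" and
        eqs: "y = y1 \<oplus>\<^bsub>B\<^esub> r1 \<odot>\<^bsub>B\<^esub> x" "u = u1 \<oplus>\<^bsub>Q\<^esub> r1 \<odot>\<^bsub>Q\<^esub> q"
        "z = y2 \<oplus>\<^bsub>B\<^esub> r2 \<odot>\<^bsub>B\<^esub> x" "v = u2 \<oplus>\<^bsub>Q\<^esub> r2 \<odot>\<^bsub>Q\<^esub> q"
        by (auto simp: G'_def)
      have "y \<oplus>\<^bsub>B\<^esub> z = (y1 \<oplus>\<^bsub>B\<^esub> y2) \<oplus>\<^bsub>B\<^esub> (r1 \<oplus> r2) \<odot>\<^bsub>B\<^esub> x"
        "u \<oplus>\<^bsub>Q\<^esub> v = (u1 \<oplus>\<^bsub>Q\<^esub> u2) \<oplus>\<^bsub>Q\<^esub> (r1 \<oplus> r2) \<odot>\<^bsub>Q\<^esub> q"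
        using * x q(1) G_carrier
        by (simp_all add: eqs B.smult_l_distr Q.smult_l_distr B.smult_closed Q.smult_closed
            B.M.a_ac Q.M.a_ac)
      then show "(y \<oplus>\<^bsub>B\<^esub> z, u \<oplus>\<^bsub>Q\<^esub> v) \<in> G'"
        unfolding G'_def using G_add * by blast
    next
      fix a y u assume "a \<in> carrier R \<and> (y, u) \<in> G'"
      then obtain y1 u1 r1 where *: "a \<in> carrier R" "(y1, u1) \<in> G" "r1 \<in> carrier R" and
        eqs: "y = y1 \<oplus>\<^bsub>B\<^esub> r1 \<odot>\<^bsub>B\<^esub> x" "u = u1 \<oplus>\<^bsub>Q\<^esub> r1 \<odot>\<^bsub>Q\<^esub> q"
        by (auto simp: G'_def)
      have "a \<odot>\<^bsub>B\<^esub> y = a \<odot>\<^bsub>B\<^esub> y1 \<oplus>\<^bsub>B\<^esub> (a \<otimes> r1) \<odot>\<^bsub>B\<^esub> x"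
        "a \<odot>\<^bsub>Q\<^esub> u = a \<odot>\<^bsub>Q\<^esub> u1 \<oplus>\<^bsub>Q\<^esub> (a \<otimes> r1) \<odot>\<^bsub>Q\<^esub> q"
        using * x q(1) G_carrier
        by (simp_all add: eqs B.smult_r_distr Q.smult_r_distr B.smult_closed Q.smult_closed
            B.smult_assoc1 Q.smult_assoc1)
      then show "(a \<odot>\<^bsub>B\<^esub> y, a \<odot>\<^bsub>Q\<^esub> u) \<in> G'"
        unfolding G'_def using G_smult * by blast
    next
      fix y u v assume "(y, u) \<in> G' \<and> (y, v) \<in> G'"
      then obtain y1 u1 r1 y2 u2 r2 where *: "(y1, u1) \<in> G" "(y2, u2) \<in> G"
        "r1 \<in> carrier R" "r2 \<in> carrier R" and
        eqs: "y1 \<oplus>\<^bsub>B\<^esub> r1 \<odot>\<^bsub>B\<^esub> x = y2 \<oplus>\<^bsub>B\<^esub> r2 \<odot>\<^bsub>B\<^esub> x"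
        "u = u1 \<oplus>\<^bsub>Q\<^esub> r1 \<odot>\<^bsub>Q\<^esub> q" "v = u2 \<oplus>\<^bsub>Q\<^esub> r2 \<odot>\<^bsub>Q\<^esub> q"
        by (auto simp: G'_def)
      note [simp] = G_carrier[OF *(1)] G_carrier[OF *(2)] x q(1) *(3,4)
        B.smult_closed Q.smult_closed
      \<comment> \<open>Subtracting the two decompositions puts (r1 - r2) x into the domain of G,
        where \<open>hq\<close> forces the value (r1 - r2) q; this equals u2 - u1, so the two values
        of the extended map coincide.\<close>
      have "(r1 \<ominus> r2) \<odot>\<^bsub>B\<^esub> x = r1 \<odot>\<^bsub>B\<^esub> x \<ominus>\<^bsub>B\<^esub> r2 \<odot>\<^bsub>B\<^esub> x"
        by (simp add: a_minus_def B.smult_l_distr B.smult_l_minus)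
      also have "\<dots> = y2 \<ominus>\<^bsub>B\<^esub> y1"
      proof -
        have "y2 \<oplus>\<^bsub>B\<^esub> r2 \<odot>\<^bsub>B\<^esub> x \<oplus>\<^bsub>B\<^esub> (\<ominus>\<^bsub>B\<^esub> y1 \<oplus>\<^bsub>B\<^esub> \<ominus>\<^bsub>B\<^esub> (r2 \<odot>\<^bsub>B\<^esub> x))
          = y2 \<ominus>\<^bsub>B\<^esub> y1"
          by (simp add: a_minus_def B.M.a_ac B.M.r_neg1 B.M.r_neg2 B.M.r_neg)
        moreover have "y1 \<oplus>\<^bsub>B\<^esub> r1 \<odot>\<^bsub>B\<^esub> x \<oplus>\<^bsub>B\<^esub> (\<ominus>\<^bsub>B\<^esub> y1 \<oplus>\<^bsub>B\<^esub> \<ominus>\<^bsub>B\<^esub> (r2 \<odot>\<^bsub>B\<^esub> x))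
          = r1 \<odot>\<^bsub>B\<^esub> x \<ominus>\<^bsub>B\<^esub> r2 \<odot>\<^bsub>B\<^esub> x"
          by (simp add: a_minus_def B.M.a_ac B.M.r_neg1 B.M.r_neg2 B.M.r_neg)
        ultimately show ?thesis
          using eqs(1) by simp
      qed
      finally have "((r1 \<ominus> r2) \<odot>\<^bsub>B\<^esub> x, u2 \<ominus>\<^bsub>Q\<^esub> u1) \<in> G"
        using G_minus[OF *(2,1)] by simp
      then have "u2 \<ominus>\<^bsub>Q\<^esub> u1 = (r1 \<ominus> r2) \<odot>\<^bsub>Q\<^esub> q"
        by (intro hq) auto
      then have "u1 \<oplus>\<^bsub>Q\<^esub> (u2 \<ominus>\<^bsub>Q\<^esub> u1) \<oplus>\<^bsub>Q\<^esub> r2 \<odot>\<^bsub>Q\<^esub> q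
          = u1 \<oplus>\<^bsub>Q\<^esub> (r1 \<odot>\<^bsub>Q\<^esub> q \<ominus>\<^bsub>Q\<^esub> r2 \<odot>\<^bsub>Q\<^esub> q) \<oplus>\<^bsub>Q\<^esub> r2 \<odot>\<^bsub>Q\<^esub> q"
        by (simp add: a_minus_def Q.smult_l_distr Q.smult_l_minus)
      moreover have "u1 \<oplus>\<^bsub>Q\<^esub> (u2 \<ominus>\<^bsub>Q\<^esub> u1) = u2"
        by (simp add: Q.M.add_minus_cancel)
      moreover have "u1 \<oplus>\<^bsub>Q\<^esub> (r1 \<odot>\<^bsub>Q\<^esub> q \<ominus>\<^bsub>Q\<^esub> r2 \<odot>\<^bsub>Q\<^esub> q) \<oplus>\<^bsub>Q\<^esub> r2 \<odot>\<^bsub>Q\<^esub> q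
          = u1 \<oplus>\<^bsub>Q\<^esub> r1 \<odot>\<^bsub>Q\<^esub> q"
        by (simp add: a_minus_def Q.M.a_assoc Q.M.l_neg)
      ultimately show "u = v"
        by (simp add: eqs)
    qed
    then have "G' = G"
      using max sub by blast
    moreover have "(\<zero>\<^bsub>B\<^esub> \<oplus>\<^bsub>B\<^esub> \<one> \<odot>\<^bsub>B\<^esub> x, \<zero>\<^bsub>Q\<^esub> \<oplus>\<^bsub>Q\<^esub> \<one> \<odot>\<^bsub>Q\<^esub> q) \<in> G'"
      unfolding G'_def using zero by blast
    ultimately show ?thesis
      using x by (auto simp: B.smult_one)
  qed
  define g where "g x = (SOME u. (x, u) \<in> G)" for x
  have g: "(x, g x) \<in> G" if "x \<in> carrier B" for x
    unfolding g_def using total[OF that] by (rule someI_ex)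
  have g_eq: "g x = u" if "(x, u) \<in> G" for x u
    using that g G_carrier G_unique by blast
  show thesis
  proof (rule that)
    show "g \<in> left_module_hom R B Q"
      by (rule left_module_homI) (use g G_carrier(2)[OF g] G_add[OF g g] G_smult[OF _ g] g_eq in auto)
    show "g x = f x" if "x \<in> A" for x
      using that G_f g_eq by blast
  qed
qed

text \<open>An arbitrary \<open>J\<close>-extension is replaced by the inclusion of the image of i,
  along which f is transported. The types \<open>'a\<close> and \<open>'b\<close> are unrestricted,
  in contrast to \<open>J_injective_imp_baer\<close>.\<close>

lemma (in filtered_ring) baer_imp_J_injective:
  fixes Q :: "('r, 'q, 'z) module_scheme"
  assumes "baer R J Q" "left_module R Q"
  shows "J_injective TYPE('a) TYPE('b) R J Q"
  unfolding J_injective_def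
proof (intro allI impI, elim conjE)
  fix A :: "('r, 'a) module" and B :: "('r, 'b) module" and i f
  assume ext: "J_extension R J A B i" and f: "f \<in> left_module_hom R A Q"
  then have i: "left_module_homomorphism R A B i" and inj: "inj_on i (carrier A)"
    and colon: "carrier B \<subseteq> colon J B (i ` carrier A)"
    by (auto simp: J_extension_def left_module_homomorphism_def left_module_homomorphism_axioms_def)
  interpret i: left_module_homomorphism R A B i by fact
  define f' where "f' = f \<circ> inv_into (carrier A) i"
  have f'i: "f' (i x) = f x" if "x \<in> carrier A" for x
    using that inj by (simp add: f'_def)
  have "f' \<in> left_module_hom R (B\<lparr>carrier := i ` carrier A\<rparr>) Q"
    by (rule left_module_homI)
      (use left_module_homD[OF f] in \<open>auto simp: f'i i.A.smult_closed
          simp flip: i.hom_add i.hom_smult\<close>)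
  then obtain g where "g \<in> left_module_hom R B Q" "\<And>x. x \<in> i ` carrier A \<Longrightarrow> g x = f' x"
    using baer_extend[OF assms i.B.left_module_axioms
        i.image_submodule[OF i.A.left_submodule_carrier] colon] by metis
  then show "\<exists>g\<in>left_module_hom R B Q. \<forall>x\<in>carrier A. f x = g (i x)"
    using f'i by (intro bexI[of _ g]) auto
qed

section \<open>A saturated injective extension\<close>

lemma (in left_module) submodule_hom:
  assumes "left_module R Q" "submodule A R M" "f \<in> left_module_hom R (M\<lparr>carrier := A\<rparr>) Q"
  shows "\<And>x. x \<in> A \<Longrightarrow> f x \<in> carrier Q"
    and "\<And>x y. \<lbrakk>x \<in> A; y \<in> A\<rbrakk> \<Longrightarrow> f (x \<oplus>\<^bsub>M\<^esub> y) = f x \<oplus>\<^bsub>Q\<^esub> f y"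
    and "\<And>a x. \<lbrakk>a \<in> carrier R; x \<in> A\<rbrakk> \<Longrightarrow> f (a \<odot>\<^bsub>M\<^esub> x) = a \<odot>\<^bsub>Q\<^esub> f x"
    and "f \<zero>\<^bsub>M\<^esub> = \<zero>\<^bsub>Q\<^esub>"
    and "\<And>x y. \<lbrakk>x \<in> A; y \<in> A\<rbrakk> \<Longrightarrow> f (x \<ominus>\<^bsub>M\<^esub> y) = f x \<ominus>\<^bsub>Q\<^esub> f y"
    and "\<And>D. submodule D R Q \<Longrightarrow> submodule {x \<in> A. f x \<in> D} R M"
proof -
  interpret Q: left_module R Q by fact
  note A = left_submoduleD[OF assms(2)]
  show closed: "f x \<in> carrier Q" if "x \<in> A" for x
    using left_module_homD(1)[OF assms(3)] that by simp
  show add: "f (x \<oplus>\<^bsub>M\<^esub> y) = f x \<oplus>\<^bsub>Q\<^esub> f y" if "x \<in> A" "y \<in> A" for x y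
    using left_module_homD(2)[OF assms(3)] that by simp
  show smult: "f (a \<odot>\<^bsub>M\<^esub> x) = a \<odot>\<^bsub>Q\<^esub> f x" if "a \<in> carrier R" "x \<in> A" for a x
    using left_module_homD(3)[OF assms(3)] that by simp
  show zero: "f \<zero>\<^bsub>M\<^esub> = \<zero>\<^bsub>Q\<^esub>"
    using smult[of \<zero> "\<zero>\<^bsub>M\<^esub>"] A(2) closed[OF A(2)] by (simp add: smult_l_null Q.smult_l_null)
  show "f (x \<ominus>\<^bsub>M\<^esub> y) = f x \<ominus>\<^bsub>Q\<^esub> f y" if xy: "x \<in> A" "y \<in> A" for x y
  proof -
    have "\<ominus>\<^bsub>M\<^esub> y = (\<ominus> \<one>) \<odot>\<^bsub>M\<^esub> y"
      using A(3)[OF xy(2)] by (simp add: smult_l_minus smult_one)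
    moreover have "f ((\<ominus> \<one>) \<odot>\<^bsub>M\<^esub> y) = \<ominus>\<^bsub>Q\<^esub> f y"
      using xy closed by (simp add: smult Q.smult_l_minus Q.smult_one)
    ultimately show ?thesis
      using xy A(5)[OF xy(2)] by (simp add: a_minus_def add)
  qed
  show "submodule {x \<in> A. f x \<in> D} R M" if D: "submodule D R Q" for D
    using A(1) Q.left_submoduleD(2,4,7)[OF D] A(2,4,7)
    by (intro left_submoduleI) (auto simp: zero add smult)
qed

lemma (in left_module) submodule_of_submodule:
  assumes "submodule A R M" "submodule B R M" "A \<subseteq> B"
  shows "submodule A R (M\<lparr>carrier := B\<rparr>)"
proof -
  interpret B: left_module R "M\<lparr>carrier := B\<rparr>"
    using assms(2) by (rule left_module_submodule)
  show ?thesis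
    by (rule B.left_submoduleI) (use assms(3) left_submoduleD[OF assms(1)] in auto)
qed

text \<open>For \<open>f : L \<rightarrow> \<Gamma>\<close>, extend the restriction of \<open>f\<close> to \<open>f\<inverse>(\<iota> M)\<close>, which contains an element of \<open>J\<close> by
  completeness. The difference with \<open>f\<close> takes values in \<open>\<Gamma>[J] \<cong> T\<close>, hence extends as well.\<close>

lemma (in complete_filtered_ring) baer_if_saturated:
  fixes \<Gamma> :: "('r, 'g, 'y) module_scheme" and T :: "('r, 't, 'z) module_scheme"
    and M :: "('r, 'm, 'x) module_scheme"
  assumes T: "left_module R T" "baer R J T"
    and ext: "JT_extension R J T M s \<Gamma> \<iota> \<tau>" and sat: "saturated J T \<Gamma> \<tau>"
    and extend: "\<And>L f I. \<lbrakk>submodule L R (regular_module R); I \<in> J; I \<subseteq> L;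
      f \<in> left_module_hom R (regular_module R\<lparr>carrier := L\<rparr>) M\<rbrakk> \<Longrightarrow>
      \<exists>g\<in>carrier \<Gamma>. \<forall>l\<in>L. \<iota> (f l) = l \<odot>\<^bsub>\<Gamma>\<^esub> g"
  shows "baer R J \<Gamma>"
  unfolding baer_def
proof (intro allI impI, elim conjE bexE)
  fix L f I
  assume L: "submodule L R (regular_module R)" and I: "I \<in> J" "I \<subseteq> L"
    and f: "f \<in> left_module_hom R (regular_module R\<lparr>carrier := L\<rparr>) \<Gamma>"
  interpret reg: left_module R "regular_module R"
    by (rule left_module_regular) (rule ring_axioms)
  interpret \<iota>: left_module_homomorphism R M \<Gamma> \<iota>
    using ext by (simp add: JT_extension_def J_extension_def left_module_homomorphism_def
        left_module_homomorphism_axioms_def)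
  have inj: "inj_on \<iota> (carrier M)" and colon: "colon J \<Gamma> (\<iota> ` carrier M) = carrier \<Gamma>"
    and \<tau>: "\<tau> \<in> left_module_hom R (\<Gamma>\<lparr>carrier := torsion J \<Gamma>\<rparr>) T" "inj_on \<tau> (torsion J \<Gamma>)"
    using ext by (simp_all add: JT_extension_def J_extension_def pointed_module_def)
  note L' = reg.left_submoduleD[OF L, simplified]
  note f' = reg.submodule_hom[OF \<iota>.B.left_module_axioms L f, simplified]
  have tors: "submodule (torsion J \<Gamma>) R \<Gamma>"
    by (rule torsion_submodule) (rule \<iota>.B.left_module_axioms)
  note tors' = \<iota>.B.left_submoduleD[OF tors]
  note \<tau>' = \<iota>.B.submodule_hom[OF T(1) tors \<tau>(1)]
  define D where "D = {l \<in> L. f l \<in> \<iota> ` carrier M}"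
  have im: "submodule (\<iota> ` carrier M) R \<Gamma>"
    by (rule \<iota>.image_submodule) (rule \<iota>.A.left_submodule_carrier)
  have D: "submodule D R (regular_module R)"
    unfolding D_def using im by (rule reg.submodule_hom(6)[OF \<iota>.B.left_module_axioms L f])
  have D_L: "D \<subseteq> L" and D_carrier: "\<And>l. l \<in> D \<Longrightarrow> l \<in> carrier R"
    using L'(1) by (auto simp: D_def)
  have L_D: "\<exists>K\<in>J. \<forall>k\<in>K. k \<otimes> l \<in> D" if l: "l \<in> L" for l
  proof -
    have "f l \<in> colon J \<Gamma> (\<iota> ` carrier M)"
      using colon f'(1)[OF l] by simp
    then obtain K where K: "K \<in> J" "\<forall>k\<in>K. k \<odot>\<^bsub>\<Gamma>\<^esub> f l \<in> \<iota> ` carrier M"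
      by (auto simp: colon_iff)
    then have "\<forall>k\<in>K. k \<otimes> l \<in> D"
      using l filter_carrier[OF K(1)] by (simp add: D_def L'(7) f'(3))
    then show ?thesis
      using K(1) by blast
  qed
  \<comment> \<open>Each a in I lies in L, so some K in \<open>J\<close> has
    \<open>K a \<subseteq> D\<close>; by completeness a single member of \<open>J\<close> lies in D
    itself.\<close>
  have "\<exists>K\<in>J. K \<subseteq> D"
    using L_D I(2) by (intro complete[OF D I(1)]) blast
  then obtain K where K: "K \<in> J" "K \<subseteq> D"
    by blast
  define f0 where "f0 = inv_into (carrier M) \<iota> \<circ> f"
  have f0: "f0 l \<in> carrier M" "\<iota> (f0 l) = f l" if "l \<in> D" for l
    using that by (simp_all add: D_def f0_def inv_into_into f_inv_into_f)
  have "f0 \<in> left_module_hom R (regular_module R\<lparr>carrier := D\<rparr>) M"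
  proof (rule left_module_homI)
    fix l l' assume l: "l \<in> carrier (regular_module R\<lparr>carrier := D\<rparr>)"
      "l' \<in> carrier (regular_module R\<lparr>carrier := D\<rparr>)"
    then have "\<iota> (f0 (l \<oplus> l')) = \<iota> (f0 l \<oplus>\<^bsub>M\<^esub> f0 l')"
      using D_L reg.left_submoduleD(4)[OF D] by (simp add: f0 \<iota>.hom_add f'(2) subset_eq)
    then show "f0 (l \<oplus>\<^bsub>regular_module R\<lparr>carrier := D\<rparr>\<^esub> l') = f0 l \<oplus>\<^bsub>M\<^esub> f0 l'"
      using l reg.left_submoduleD(4)[OF D] inj_onD[OF inj] by (simp add: f0)
  next
    fix a l assume l: "a \<in> carrier R" "l \<in> carrier (regular_module R\<lparr>carrier := D\<rparr>)"
    then have "\<iota> (f0 (a \<otimes> l)) = \<iota> (a \<odot>\<^bsub>M\<^esub> f0 l)"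
      using D_L reg.left_submoduleD(7)[OF D] by (simp add: f0 \<iota>.hom_smult f'(3) subset_eq)
    then show "f0 (a \<odot>\<^bsub>regular_module R\<lparr>carrier := D\<rparr>\<^esub> l) = a \<odot>\<^bsub>M\<^esub> f0 l"
      using l reg.left_submoduleD(7)[OF D] inj_onD[OF inj] by (simp add: f0 \<iota>.A.smult_closed)
  qed (simp add: f0)
  from extend[OF D K this] obtain g
    where g: "g \<in> carrier \<Gamma>" "\<And>l. l \<in> D \<Longrightarrow> f l = l \<odot>\<^bsub>\<Gamma>\<^esub> g"
    using f0(2) by auto
  define h where "h l = f l \<ominus>\<^bsub>\<Gamma>\<^esub> l \<odot>\<^bsub>\<Gamma>\<^esub> g" for l
  have h_closed: "h l \<in> carrier \<Gamma>" if "l \<in> L" for l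
    using that f'(1) L'(3) g(1) by (simp add: h_def \<iota>.B.smult_closed)
  have h_add: "h (l \<oplus> l') = h l \<oplus>\<^bsub>\<Gamma>\<^esub> h l'" if "l \<in> L" "l' \<in> L" for l l'
    using that f'(1) L'(3) g(1)
    by (simp add: h_def f'(2) \<iota>.B.smult_l_distr a_minus_def \<iota>.B.M.minus_add \<iota>.B.M.a_ac
        \<iota>.B.smult_closed)
  have h_smult: "h (a \<otimes> l) = a \<odot>\<^bsub>\<Gamma>\<^esub> h l" if "a \<in> carrier R" "l \<in> L" for a l
    using that f'(1) L'(3) g(1)
    by (simp add: h_def f'(3) \<iota>.B.smult_assoc1 \<iota>.B.smult_r_diff \<iota>.B.smult_closed)
  \<comment> \<open>If k l is in D, then g solves the problem at k l, so h (k l) = 0; by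
    \<open>L_D\<close> this holds for all k in some member of \<open>J\<close>.\<close>
  have h_torsion: "h l \<in> torsion J \<Gamma>" if l: "l \<in> L" for l
  proof -
    obtain K where K: "K \<in> J" "\<forall>k\<in>K. k \<otimes> l \<in> D"
      using L_D l by blast
    have "k \<odot>\<^bsub>\<Gamma>\<^esub> h l = \<zero>\<^bsub>\<Gamma>\<^esub>" if k: "k \<in> K" for k
    proof -
      have kR: "k \<in> carrier R" and kl: "k \<otimes> l \<in> D"
        using filter_carrier K k by auto
      have "k \<odot>\<^bsub>\<Gamma>\<^esub> h l = h (k \<otimes> l)"
        using h_smult kR l by simp
      also have "\<dots> = \<zero>\<^bsub>\<Gamma>\<^esub>"
        using g kl D_carrier by (simp add: h_def \<iota>.B.M.minus_eq_zero_iff \<iota>.B.smult_closed)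
      finally show ?thesis .
    qed
    then show ?thesis
      using K(1) h_closed[OF l] by (auto simp: torsion_iff)
  qed
  have "(\<lambda>l. \<tau> (h l)) \<in> left_module_hom R (regular_module R\<lparr>carrier := L\<rparr>) T"
    by (rule left_module_homI) (simp_all add: h_torsion h_add h_smult \<tau>')
  then obtain w where w: "w \<in> carrier T" "\<And>l. l \<in> L \<Longrightarrow> \<tau> (h l) = l \<odot>\<^bsub>T\<^esub> w"
    using T(2) L I unfolding baer_def by blast
  \<comment> \<open>Saturation lifts the solution w in \<open>T\<close> to a torsion element v of
    \<Gamma>. Injectivity of \<tau> then gives h l = l v, so g + v solves the original
    problem.\<close>
  obtain v where v: "v \<in> torsion J \<Gamma>" "w = \<tau> v"
    using sat w(1) unfolding saturated_def by blast
  have "f l = l \<odot>\<^bsub>\<Gamma>\<^esub> (g \<oplus>\<^bsub>\<Gamma>\<^esub> v)" if l: "l \<in> L" for l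
  proof -
    note lR = L'(3)[OF l]
    have "\<tau> (h l) = \<tau> (l \<odot>\<^bsub>\<Gamma>\<^esub> v)"
      using w(2)[OF l] v lR by (simp add: \<tau>'(3))
    then have "h l = l \<odot>\<^bsub>\<Gamma>\<^esub> v"
      by (rule inj_onD[OF \<tau>(2)]) (use h_torsion[OF l] tors'(7) lR v(1) in auto)
    then have "l \<odot>\<^bsub>\<Gamma>\<^esub> (g \<oplus>\<^bsub>\<Gamma>\<^esub> v) = l \<odot>\<^bsub>\<Gamma>\<^esub> g \<oplus>\<^bsub>\<Gamma>\<^esub> (f l \<ominus>\<^bsub>\<Gamma>\<^esub> l \<odot>\<^bsub>\<Gamma>\<^esub> g)"
      using lR g(1) tors'(3)[OF v(1)] by (simp add: \<iota>.B.smult_r_distr h_def)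
    then show ?thesis
      using lR g(1) f'(1)[OF l] by (simp add: \<iota>.B.M.add_minus_cancel \<iota>.B.smult_closed)
  qed
  then show "\<exists>q\<in>carrier \<Gamma>. \<forall>l\<in>L. f l = l \<odot>\<^bsub>\<Gamma>\<^esub> q"
    using g(1) tors'(3)[OF v(1)] by (intro bexI[of _ "g \<oplus>\<^bsub>\<Gamma>\<^esub> v"]) auto
qed

lemma (in left_module) finsum_smult:
  assumes "finite A" "a \<in> carrier R" "f \<in> A \<rightarrow> carrier M"
  shows "a \<odot>\<^bsub>M\<^esub> finsum M f A = finsum M (\<lambda>y. a \<odot>\<^bsub>M\<^esub> f y) A"
  using assms(1,3)
proof (induction A)
  case empty
  show ?case
    using assms(2) by (simp add: M.finsum_empty smult_r_null)
next
  case (insert y A)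
  have f: "f y \<in> carrier M" "f \<in> A \<rightarrow> carrier M"
    using insert.prems by auto
  then have "(\<lambda>y. a \<odot>\<^bsub>M\<^esub> f y) \<in> A \<rightarrow> carrier M"
    using assms(2) by (auto intro: smult_closed)
  then show ?case
    using insert f assms(2)
    by (simp add: M.finsum_insert M.finsum_closed smult_r_distr smult_closed)
qed

section \<open>The module of formal solutions and its evaluation in \<open>M\<close>\<close>

locale pointed_module_setting = complete_filtered_ring R J + T: left_module R T + M: left_module R M
  for R :: "('r, 'k) ring_scheme" (structure) and J
    and T :: "('r, 't, 'z) module_scheme" and M :: "('r, 'm, 'x) module_scheme" +
  fixes s :: "'m \<Rightarrow> 't"
  assumes T_torsion: "is_torsion J T" and T_baer: "baer R J T"
    and pointed: "pointed_module R J T M s"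
begin

text \<open>\<open>cover\<close> is \<open>T\<close> plus the free module with one generator for each extension problem \<open>f : L \<rightarrow> M\<close> in
  \<open>gens\<close>; in the extension of \<open>M\<close> constructed from it, this generator solves the problem. On
  \<open>glue_dom\<close>, the generators are only multiplied by scalars in \<open>L\<close>, and \<open>glue\<close> evaluates them to their
  prescribed values in \<open>M\<close>.\<close>

definition gens :: "('r set \<times> ('r \<Rightarrow> 'm)) set"
  where "gens = {(L, f). submodule L R (regular_module R) \<and> (\<exists>I\<in>J. I \<subseteq> L) \<and>
    f \<in> left_module_hom R (regular_module R\<lparr>carrier := L\<rparr>) M}"

definition cover :: "('r, ('r set \<times> ('r \<Rightarrow> 'm) \<Rightarrow> 'r) \<times> 't) module"
  where "cover = \<lparr>carrier = {p. (\<forall>y. fst p y \<in> carrier R) \<and> finite {y. fst p y \<noteq> \<zero>} \<and>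
      {y. fst p y \<noteq> \<zero>} \<subseteq> gens \<and> snd p \<in> carrier T},
    monoid.mult = undefined, one = undefined, ring.zero = (\<lambda>y. \<zero>, \<zero>\<^bsub>T\<^esub>),
    ring.add = (\<lambda>p p'. (\<lambda>y. fst p y \<oplus> fst p' y, snd p \<oplus>\<^bsub>T\<^esub> snd p')),
    module.smult = (\<lambda>a p. (\<lambda>y. a \<otimes> fst p y, a \<odot>\<^bsub>T\<^esub> snd p))\<rparr>"

lemma cover_simps:
  "\<zero>\<^bsub>cover\<^esub> = (\<lambda>y. \<zero>, \<zero>\<^bsub>T\<^esub>)"
  "p \<oplus>\<^bsub>cover\<^esub> p' = (\<lambda>y. fst p y \<oplus> fst p' y, snd p \<oplus>\<^bsub>T\<^esub> snd p')"
  "a \<odot>\<^bsub>cover\<^esub> p = (\<lambda>y. a \<otimes> fst p y, a \<odot>\<^bsub>T\<^esub> snd p)"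
  by (simp_all add: cover_def)

lemma cover_carrier:
  "p \<in> carrier cover \<longleftrightarrow> (\<forall>y. fst p y \<in> carrier R) \<and> finite {y. fst p y \<noteq> \<zero>} \<and>
      {y. fst p y \<noteq> \<zero>} \<subseteq> gens \<and> snd p \<in> carrier T"
  by (simp add: cover_def)

lemma coverD:
  assumes "p \<in> carrier cover" shows "fst p y \<in> carrier R" "snd p \<in> carrier T"
  using assms by (simp_all add: cover_carrier del: split_paired_All)

lemma cover_add_closed:
  assumes "p \<in> carrier cover" "p' \<in> carrier cover" shows "p \<oplus>\<^bsub>cover\<^esub> p' \<in> carrier cover"
proof -
  have "{y. fst p y \<oplus> fst p' y \<noteq> \<zero>} \<subseteq> {y. fst p y \<noteq> \<zero>} \<union> {y. fst p' y \<noteq> \<zero>}"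
    by (auto simp: r_zero)
  moreover have "finite ({y. fst p y \<noteq> \<zero>} \<union> {y. fst p' y \<noteq> \<zero>})"
    using assms by (simp add: cover_carrier)
  moreover have "{y. fst p y \<noteq> \<zero>} \<union> {y. fst p' y \<noteq> \<zero>} \<subseteq> gens"
    using assms by (simp add: cover_carrier)
  ultimately have "finite {y. fst p y \<oplus> fst p' y \<noteq> \<zero>}" "{y. fst p y \<oplus> fst p' y \<noteq> \<zero>} \<subseteq> gens"
    by - (rule finite_subset, assumption+, rule order_trans, assumption+)
  then show ?thesis
    using assms by (simp add: cover_carrier cover_simps)
qed

lemma cover_smult_closed:
  assumes "a \<in> carrier R" "p \<in> carrier cover" shows "a \<odot>\<^bsub>cover\<^esub> p \<in> carrier cover"
proof -
  have "{y. a \<otimes> fst p y \<noteq> \<zero>} \<subseteq> {y. fst p y \<noteq> \<zero>}"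
    using assms by auto
  moreover have "finite {y. fst p y \<noteq> \<zero>}" "{y. fst p y \<noteq> \<zero>} \<subseteq> gens"
    using assms by (simp_all add: cover_carrier)
  ultimately have "finite {y. a \<otimes> fst p y \<noteq> \<zero>}" "{y. a \<otimes> fst p y \<noteq> \<zero>} \<subseteq> gens"
    by - (rule finite_subset, assumption+, rule order_trans, assumption+)
  then show ?thesis
    using assms by (simp add: cover_carrier cover_simps T.smult_closed)
qed

lemma cover_module: "left_module R cover"
proof (rule left_moduleI)
  show "abelian_group cover"
  proof (rule abelian_groupI)
    fix p assume p: "p \<in> carrier cover"
    then have "(\<ominus> \<one>) \<otimes> fst p y \<oplus> fst p y = \<zero>" for y
      by (simp add: coverD l_minus l_neg)
    then have "(\<ominus> \<one>) \<odot>\<^bsub>cover\<^esub> p \<oplus>\<^bsub>cover\<^esub> p = \<zero>\<^bsub>cover\<^esub>"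
      using p by (simp add: cover_simps coverD T.smult_l_minus T.smult_one T.M.l_neg)
    then show "\<exists>p'\<in>carrier cover. p' \<oplus>\<^bsub>cover\<^esub> p = \<zero>\<^bsub>cover\<^esub>"
      using cover_smult_closed p by blast
  next
    show "\<zero>\<^bsub>cover\<^esub> \<in> carrier cover"
      by (simp add: cover_carrier cover_simps)
  next
    fix p p' assume "p \<in> carrier cover" "p' \<in> carrier cover"
    then show "p \<oplus>\<^bsub>cover\<^esub> p' \<in> carrier cover"
      by (rule cover_add_closed)
  qed (simp_all add: cover_simps coverD a_ac T.M.a_ac)
next
  fix a p assume "a \<in> carrier R" "p \<in> carrier cover"
  then show "a \<odot>\<^bsub>cover\<^esub> p \<in> carrier cover"
    by (rule cover_smult_closed)
qed (simp_all add: ring_axioms cover_simps coverD l_distr r_distr m_assoc T.smult_l_distr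
    T.smult_r_distr T.smult_assoc1 T.smult_one)

lemma gensD:
  assumes "y \<in> gens"
  shows "submodule (fst y) R (regular_module R)" "\<exists>I\<in>J. I \<subseteq> fst y"
    "snd y \<in> left_module_hom R (regular_module R\<lparr>carrier := fst y\<rparr>) M"
  using assms by (simp_all add: gens_def case_prod_beta)

lemmas gens_submodule = left_module.left_submoduleD[OF left_module_regular[OF ring_axioms] gensD(1),
    simplified]
lemmas gens_hom = left_module.submodule_hom[OF left_module_regular[OF ring_axioms]
    M.left_module_axioms gensD(1) gensD(3), simplified]

definition glue_dom :: "(('r set \<times> ('r \<Rightarrow> 'm) \<Rightarrow> 'r) \<times> 't) set"
  where "glue_dom = {p \<in> carrier cover. \<forall>y\<in>gens. fst p y \<in> fst y}"

definition glue :: "('r set \<times> ('r \<Rightarrow> 'm) \<Rightarrow> 'r) \<times> 't \<Rightarrow> 'm"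
  where "glue p = finsum M (\<lambda>y. snd y (fst p y)) {y. fst p y \<noteq> \<zero>}"

lemma glue_dom_submodule: "submodule glue_dom R cover"
proof (rule left_module.left_submoduleI[OF cover_module])
  show "\<zero>\<^bsub>cover\<^esub> \<in> glue_dom"
    using abelian_groupE(2)[OF left_module.axioms(2)[OF cover_module]] gens_submodule(2)
    by (simp add: glue_dom_def cover_simps)
next
  fix p p' assume p: "p \<in> glue_dom" "p' \<in> glue_dom"
  then show "p \<oplus>\<^bsub>cover\<^esub> p' \<in> glue_dom"
    using cover_add_closed[of p p'] gens_submodule(4)
    by (simp add: glue_dom_def cover_simps del: split_paired_All)
next
  fix a p assume p: "a \<in> carrier R" "p \<in> glue_dom"
  then show "a \<odot>\<^bsub>cover\<^esub> p \<in> glue_dom"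
    using cover_smult_closed[of a p] gens_submodule(7)
    by (simp add: glue_dom_def cover_simps)
qed (simp add: glue_dom_def)

lemma glue_terms: "\<lbrakk>p \<in> glue_dom; y \<in> gens\<rbrakk> \<Longrightarrow> snd y (fst p y) \<in> carrier M"
  by (simp add: glue_dom_def gens_hom(1))

text \<open>\<open>glue\<close> sums over the support, which changes under addition and scaling.
  Since homomorphisms vanish at zero, the sum may be taken over any larger finite set of generators;
  this supplies the common index set in \<open>glue_hom\<close>.\<close>

lemma glue_eq:
  assumes "p \<in> glue_dom" "finite A" "{y. fst p y \<noteq> \<zero>} \<subseteq> A" "A \<subseteq> gens"
  shows "glue p = finsum M (\<lambda>y. snd y (fst p y)) A"
  unfolding glue_def
proof (rule M.add.finprod_mono_neutral_cong_left)
  show "(\<lambda>y. snd y (fst p y)) \<in> A \<rightarrow> carrier M"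
    using glue_terms[OF assms(1)] assms(4) by blast
  fix y assume "y \<in> A - {y. fst p y \<noteq> \<zero>}"
  then show "snd y (fst p y) = \<zero>\<^bsub>M\<^esub>"
    using assms(4) gens_hom(4)[of y] by auto
qed (use assms in auto)

lemma glue_hom: "glue \<in> left_module_hom R (cover\<lparr>carrier := glue_dom\<rparr>) M"
proof -
  have supp: "finite {y. fst p y \<noteq> \<zero>}" "{y. fst p y \<noteq> \<zero>} \<subseteq> gens"
    if "p \<in> glue_dom" for p
    using that by (simp_all add: glue_dom_def cover_carrier)
  note dom = left_module.left_submoduleD[OF cover_module glue_dom_submodule]
  show ?thesis
  proof (rule left_module_homI)
    fix p assume p: "p \<in> carrier (cover\<lparr>carrier := glue_dom\<rparr>)"
    then show "glue p \<in> carrier M"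
      unfolding glue_def using glue_terms[of p] supp(2)[of p] by (intro M.finsum_closed) auto
  next
    fix p p' assume p: "p \<in> carrier (cover\<lparr>carrier := glue_dom\<rparr>)"
      "p' \<in> carrier (cover\<lparr>carrier := glue_dom\<rparr>)"
    define A where "A = {y. fst p y \<noteq> \<zero>} \<union> {y. fst p' y \<noteq> \<zero>}"
    have A: "finite A" "A \<subseteq> gens"
      using p supp by (auto simp: A_def)
    have terms: "snd y (fst p y) \<in> carrier M" "snd y (fst p' y) \<in> carrier M" if "y \<in> A" for y
      using subsetD[OF A(2) that] p by (simp_all add: glue_terms)
    have "glue (p \<oplus>\<^bsub>cover\<^esub> p') = finsum M (\<lambda>y. snd y (fst (p \<oplus>\<^bsub>cover\<^esub> p') y)) A"
      using p A dom(4) by (intro glue_eq) (auto simp: A_def cover_simps)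
    also have "\<dots> = finsum M (\<lambda>y. snd y (fst p y) \<oplus>\<^bsub>M\<^esub> snd y (fst p' y)) A"
    proof (rule M.finsum_cong')
      show "(\<lambda>y. snd y (fst p y) \<oplus>\<^bsub>M\<^esub> snd y (fst p' y)) \<in> A \<rightarrow> carrier M"
        using terms by simp
      fix y assume "y \<in> A"
      then show "snd y (fst (p \<oplus>\<^bsub>cover\<^esub> p') y) = snd y (fst p y) \<oplus>\<^bsub>M\<^esub> snd y (fst p' y)"
        using subsetD[OF A(2), of y] p gens_hom(2)[of y] by (simp add: cover_simps glue_dom_def)
    qed simp
    also have "\<dots> = finsum M (\<lambda>y. snd y (fst p y)) A \<oplus>\<^bsub>M\<^esub> finsum M (\<lambda>y. snd y (fst p' y)) A"
      using terms by (intro M.finsum_addf) simp_all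
    also have "finsum M (\<lambda>y. snd y (fst p y)) A = glue p"
      using p A by (intro glue_eq[symmetric]) (simp_all add: A_def)
    also have "finsum M (\<lambda>y. snd y (fst p' y)) A = glue p'"
      using p A by (intro glue_eq[symmetric]) (simp_all add: A_def)
    finally show "glue (p \<oplus>\<^bsub>cover\<lparr>carrier := glue_dom\<rparr>\<^esub> p') = glue p \<oplus>\<^bsub>M\<^esub> glue p'"
      by simp
  next
    fix a p assume a: "a \<in> carrier R" and p: "p \<in> carrier (cover\<lparr>carrier := glue_dom\<rparr>)"
    define A where "A = {y. fst p y \<noteq> \<zero>}"
    have A: "finite A" "A \<subseteq> gens"
      using p supp by (auto simp: A_def)
    have terms: "snd y (fst p y) \<in> carrier M" if "y \<in> A" for y
      using subsetD[OF A(2) that] p by (simp_all add: glue_terms)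
    have "glue (a \<odot>\<^bsub>cover\<^esub> p) = finsum M (\<lambda>y. snd y (fst (a \<odot>\<^bsub>cover\<^esub> p) y)) A"
      using p A a dom(7) by (intro glue_eq) (auto simp: A_def cover_simps)
    also have "\<dots> = finsum M (\<lambda>y. a \<odot>\<^bsub>M\<^esub> snd y (fst p y)) A"
    proof (rule M.finsum_cong')
      show "(\<lambda>y. a \<odot>\<^bsub>M\<^esub> snd y (fst p y)) \<in> A \<rightarrow> carrier M"
        using terms a by (simp add: M.smult_closed)
      fix y assume "y \<in> A"
      then show "snd y (fst (a \<odot>\<^bsub>cover\<^esub> p) y) = a \<odot>\<^bsub>M\<^esub> snd y (fst p y)"
        using subsetD[OF A(2), of y] p a gens_hom(3)[of y] by (simp add: cover_simps glue_dom_def)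
    qed simp
    also have "\<dots> = a \<odot>\<^bsub>M\<^esub> glue p"
      unfolding glue_def A_def[symmetric]
      using A(1) a terms by (intro M.finsum_smult[symmetric]) simp_all
    finally show "glue (a \<odot>\<^bsub>cover\<lparr>carrier := glue_dom\<rparr>\<^esub> p) = a \<odot>\<^bsub>M\<^esub> glue p"
      by simp
  qed
qed

lemma glue_single:
  assumes "y \<in> gens" "r \<in> fst y" "t \<in> carrier T"
  shows "((\<lambda>z. if z = y then r else \<zero>), t) \<in> glue_dom"
    "glue ((\<lambda>z. if z = y then r else \<zero>), t) = snd y r"
proof -
  let ?p = "((\<lambda>z. if z = y then r else \<zero>), t)"
  have supp: "{z. fst ?p z \<noteq> \<zero>} \<subseteq> {y}"
    by auto
  then have "finite {z. fst ?p z \<noteq> \<zero>}"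
    by (rule finite_subset) simp
  then show p: "?p \<in> glue_dom"
    using assms supp gens_submodule(2,3) by (auto simp: glue_dom_def cover_carrier)
  have "glue ?p = finsum M (\<lambda>z. snd z (fst ?p z)) {y}"
    using p supp assms(1) by (intro glue_eq) auto
  also have "\<dots> = snd y r"
    using gens_hom(1)[OF assms(1,1,2)] by (simp add: M.finsum_insert M.finsum_empty)
  finally show "glue ?p = snd y r" .
qed

end

context pointed_module_setting
begin

text \<open>With \<open>K = ker g \<inter> ker h\<close> and \<open>C = (K :\<^sub>P J)\<close>, the map \<open>s \<circ> g + h\<close> extends to \<open>\<rho> : C \<rightarrow> T\<close> since \<open>T\<close>
  is injective, and \<open>\<Gamma> = P / ker \<rho>\<close>. Then \<open>\<Gamma>[J] = C / ker \<rho>\<close> by completeness, and \<open>\<rho>\<close> identifies it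
  with \<open>T\<close>.\<close>

lemma saturated_baer_extension_from_cover:
  fixes P :: "('r, 'p, 'w) module_scheme"
  assumes P_module: "left_module R P" and N: "submodule N R P"
    and g: "g \<in> left_module_hom R (P\<lparr>carrier := N\<rparr>) M" and h: "h \<in> left_module_hom R P T"
    and g_surj: "\<And>m. m \<in> carrier M \<Longrightarrow> \<exists>p\<in>N. g p = m \<and> h p = \<zero>\<^bsub>T\<^esub>"
    and h_surj: "\<And>t. t \<in> carrier T \<Longrightarrow> \<exists>p\<in>N. g p = \<zero>\<^bsub>M\<^esub> \<and> h p = t"
    and absorb: "\<And>p. p \<in> carrier P \<Longrightarrow> \<exists>I\<in>J. \<forall>a\<in>I. a \<odot>\<^bsub>P\<^esub> p \<in> N \<and> h (a \<odot>\<^bsub>P\<^esub> p) = \<zero>\<^bsub>T\<^esub>"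
    and solve: "\<And>L f I. \<lbrakk>submodule L R (regular_module R); I \<in> J; I \<subseteq> L;
      f \<in> left_module_hom R (regular_module R\<lparr>carrier := L\<rparr>) M\<rbrakk> \<Longrightarrow>
      \<exists>e\<in>carrier P. \<forall>l\<in>L. l \<odot>\<^bsub>P\<^esub> e \<in> N \<and> g (l \<odot>\<^bsub>P\<^esub> e) = f l \<and> h (l \<odot>\<^bsub>P\<^esub> e) = \<zero>\<^bsub>T\<^esub>"
  obtains \<Gamma> :: "('r, 'p set) module" and \<iota> \<tau>
  where "JT_extension R J T M s \<Gamma> \<iota> \<tau>" "saturated J T \<Gamma> \<tau>" "baer R J \<Gamma>"
proof -
  interpret P: left_module R P
    by (rule P_module)
  interpret h: left_module_homomorphism R P T h
    using P_module T.left_module_axioms h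
    by (simp add: left_module_homomorphism_def left_module_homomorphism_axioms_def)
  note dom = P.left_submoduleD[OF N]
  note g' = P.submodule_hom[OF M.left_module_axioms N g]
  note hs = h.hom_closed h.hom_add h.hom_smult h.hom_zero
  have s: "s \<in> left_module_hom R (M\<lparr>carrier := torsion J M\<rparr>) T" "inj_on s (torsion J M)"
    using pointed by (simp_all add: pointed_module_def)
  have M_tors: "submodule (torsion J M) R M"
    by (rule torsion_submodule) (rule M.left_module_axioms)
  note M_tors' = M.left_submoduleD[OF M_tors]
  note s' = M.submodule_hom[OF T.left_module_axioms M_tors s(1)]

  \<comment> \<open>An element p of N stands for the sum of g p in \<open>M\<close> and h p in
    \<open>T\<close>, so K collects the elements of N that must become zero.\<close>
  define K where "K = {p \<in> N. g p = \<zero>\<^bsub>M\<^esub> \<and> h p = \<zero>\<^bsub>T\<^esub>}"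
  have K: "submodule K R P"
    using dom(1,2,4,7) M.smult_r_null T.smult_r_null
    by (intro P.left_submoduleI) (auto simp: K_def g' hs subsetD)
  define C where "C = colon J P K"
  have C: "submodule C R P"
    unfolding C_def using P_module K by (rule colon_submodule)
  note C' = P.left_submoduleD[OF C]
  have K_C: "K \<subseteq> C"
    unfolding C_def using P_module K by (rule colon_superset)
  \<comment> \<open>Here the \<open>M\<close>-part is torsion, so the value in \<open>T\<close> is
    already prescribed: s (g p) + h p. That D lies in C uses that \<open>T\<close> is
    torsion.\<close>
  define D where "D = {p \<in> N. g p \<in> torsion J M}"
  have D: "submodule D R P"
    unfolding D_def
    by (rule P.submodule_hom(6)[OF M.left_module_axioms N g M_tors])
  have K_D: "K \<subseteq> D"
    using M_tors'(2) by (auto simp: K_def D_def)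
  have D_C: "D \<subseteq> C"
  proof
    fix p assume p: "p \<in> D"
    then have pd: "p \<in> N" "h p \<in> carrier T"
      using dom(3) by (auto simp: D_def hs)
    obtain I where I: "I \<in> J" "\<forall>a\<in>I. a \<odot>\<^bsub>M\<^esub> g p = \<zero>\<^bsub>M\<^esub>"
      using p by (auto simp: D_def torsion_iff)
    have "h p \<in> torsion J T"
      using T_torsion pd by (simp add: is_torsion_def)
    then obtain I' where I': "I' \<in> J" "\<forall>a\<in>I'. a \<odot>\<^bsub>T\<^esub> h p = \<zero>\<^bsub>T\<^esub>"
      by (auto simp: torsion_iff)
    have "a \<odot>\<^bsub>P\<^esub> p \<in> K" if "a \<in> I \<inter> I'" for a
    proof -
      have a: "a \<in> carrier R"
        using filter_carrier I(1) that by blast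
      then have "a \<odot>\<^bsub>P\<^esub> p \<in> N" "g (a \<odot>\<^bsub>P\<^esub> p) = \<zero>\<^bsub>M\<^esub>"
        using pd(1) I(2) that by (simp_all add: dom(7) g'(3))
      then show ?thesis
        using I'(2) that a dom(3)[OF pd(1)] by (simp add: K_def hs)
    qed
    then show "p \<in> C"
      using filter_Int[OF I(1) I'(1)] dom(3)[OF pd(1)] unfolding C_def colon_iff by blast
  qed
  have \<rho>0: "(\<lambda>p. s (g p) \<oplus>\<^bsub>T\<^esub> h p) \<in> left_module_hom R (P\<lparr>carrier := D\<rparr>) T"
  proof (rule left_module_homI)
    fix p p' assume "p \<in> carrier (P\<lparr>carrier := D\<rparr>)" "p' \<in> carrier (P\<lparr>carrier := D\<rparr>)"
    then have p: "p \<in> N" "p' \<in> N" "g p \<in> torsion J M" "g p' \<in> torsion J M"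
      and "p \<in> carrier P" "p' \<in> carrier P"
      using dom(3) by (auto simp: D_def hs)
    then show "s (g (p \<oplus>\<^bsub>P\<lparr>carrier := D\<rparr>\<^esub> p')) \<oplus>\<^bsub>T\<^esub> h (p \<oplus>\<^bsub>P\<lparr>carrier := D\<rparr>\<^esub> p')
      = s (g p) \<oplus>\<^bsub>T\<^esub> h p \<oplus>\<^bsub>T\<^esub> (s (g p') \<oplus>\<^bsub>T\<^esub> h p')"
      by (simp add: g'(2) s'(1,2) hs T.M.a_ac)
  next
    fix a p assume "a \<in> carrier R" "p \<in> carrier (P\<lparr>carrier := D\<rparr>)"
    then have p: "a \<in> carrier R" "p \<in> N" "g p \<in> torsion J M" "p \<in> carrier P"
      using dom(3) by (auto simp: D_def hs)
    then show "s (g (a \<odot>\<^bsub>P\<lparr>carrier := D\<rparr>\<^esub> p)) \<oplus>\<^bsub>T\<^esub> h (a \<odot>\<^bsub>P\<lparr>carrier := D\<rparr>\<^esub> p)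
      = a \<odot>\<^bsub>T\<^esub> (s (g p) \<oplus>\<^bsub>T\<^esub> h p)"
      by (simp add: g'(3) s'(1,3) hs T.smult_r_distr)
  next
    fix p assume "p \<in> carrier (P\<lparr>carrier := D\<rparr>)"
    then show "s (g p) \<oplus>\<^bsub>T\<^esub> h p \<in> carrier T"
      using dom(3) by (auto simp: D_def hs s'(1))
  qed
  have C_colon: "carrier (P\<lparr>carrier := C\<rparr>) \<subseteq> colon J (P\<lparr>carrier := C\<rparr>) D"
    using K_D by (auto simp: C_def colon_iff) blast
  obtain \<rho> where \<rho>: "\<rho> \<in> left_module_hom R (P\<lparr>carrier := C\<rparr>) T"
    and \<rho>_D: "\<And>p. p \<in> D \<Longrightarrow> \<rho> p = s (g p) \<oplus>\<^bsub>T\<^esub> h p"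
    using baer_extend[OF T_baer T.left_module_axioms P.left_module_submodule[OF C]
        P.submodule_of_submodule[OF D C D_C] C_colon] \<rho>0 by auto
  note \<rho>' = P.submodule_hom[OF T.left_module_axioms C \<rho>]
  define K' where "K' = {p \<in> C. \<rho> p \<in> {\<zero>\<^bsub>T\<^esub>}}"
  have K': "submodule K' R P"
    unfolding K'_def
    by (rule P.submodule_hom(6)[OF T.left_module_axioms C \<rho> T.left_submodule_zero])
  have K_K': "K \<subseteq> K'"
    using K_C K_D s'(4) by (auto simp: K'_def K_def \<rho>_D subset_eq)
  \<comment> \<open>Passing from P / K to P / K' must not produce new torsion outside C; this is
    where completeness enters, through \<open>colon_colon\<close>.\<close>
  have colon_K': "colon J P K' = C"
  proof
    have "colon J P K' \<subseteq> colon J P C"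
      by (rule colon_mono) (auto simp: K'_def)
    also have "\<dots> = C"
      unfolding C_def using P_module K by (rule colon_colon)
    finally show "colon J P K' \<subseteq> C" .
    show "C \<subseteq> colon J P K'"
      unfolding C_def by (rule colon_mono) (rule K_K')
  qed

  obtain \<Gamma> :: "('r, 'p set) module" and q
    where \<Gamma>: "left_module R \<Gamma>" and q: "q \<in> left_module_hom R P \<Gamma>"
      and \<Gamma>_carrier: "carrier \<Gamma> = q ` carrier P"
      and q_zero: "\<And>p. p \<in> carrier P \<Longrightarrow> q p = \<zero>\<^bsub>\<Gamma>\<^esub> \<longleftrightarrow> p \<in> K'"
    using quotient_module[OF P_module K'] by metis
  interpret q: left_module_homomorphism R P \<Gamma> q
    using P_module \<Gamma> q
    by (simp add: left_module_homomorphism_def left_module_homomorphism_axioms_def)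
  have q_eq: "q p = q p' \<longleftrightarrow> p \<ominus>\<^bsub>P\<^esub> p' \<in> K'" if "p \<in> carrier P" "p' \<in> carrier P" for p p'
    using that q_zero[of "p \<ominus>\<^bsub>P\<^esub> p'"]
    by (simp add: q.hom_diff q.B.M.minus_eq_zero_iff q.hom_closed)
  have torsion_q: "q p \<in> torsion J \<Gamma> \<longleftrightarrow> p \<in> C" if p: "p \<in> carrier P" for p
  proof -
    have "a \<odot>\<^bsub>\<Gamma>\<^esub> q p = \<zero>\<^bsub>\<Gamma>\<^esub> \<longleftrightarrow> a \<odot>\<^bsub>P\<^esub> p \<in> K'" if "I \<in> J" "a \<in> I" for I a
      using q_zero[of "a \<odot>\<^bsub>P\<^esub> p"] filter_carrier[OF that] p
      by (simp add: q.hom_smult P.smult_closed)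
    then show ?thesis
      using p q.hom_closed[OF p] by (simp add: torsion_iff colon_iff flip: colon_K')
  qed
  have "torsion J \<Gamma> \<subseteq> q ` carrier P"
    unfolding \<Gamma>_carrier[symmetric] by (auto simp: torsion_iff)
  then have torsion_\<Gamma>: "torsion J \<Gamma> = q ` C"
    using torsion_q C'(3) by auto
  have \<rho>_q: "\<rho> p = \<rho> p' \<longleftrightarrow> q p = q p'" if "p \<in> C" "p' \<in> C" for p p'
    using that C'(3,6)
    by (simp add: q_eq K'_def \<rho>'(5) T.M.minus_eq_zero_iff \<rho>'(1))
  define \<tau> where "\<tau> = \<rho> \<circ> inv_into C q"
  have \<tau>_q: "\<tau> (q p) = \<rho> p" if p: "p \<in> C" for p
    using p \<rho>_q[of "inv_into C q (q p)" p] by (simp add: \<tau>_def inv_into_into f_inv_into_f)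
  have \<tau>: "\<tau> \<in> left_module_hom R (\<Gamma>\<lparr>carrier := torsion J \<Gamma>\<rparr>) T"
    by (rule left_module_homI)
      (use C'(3) in \<open>auto simp: torsion_\<Gamma> \<tau>_q \<rho>' C'(4,7) simp flip: q.hom_add q.hom_smult\<close>)
  have \<tau>_inj: "inj_on \<tau> (torsion J \<Gamma>)"
    by (rule inj_onI) (auto simp: torsion_\<Gamma> \<tau>_q \<rho>_q)
  have sat: "saturated J T \<Gamma> \<tau>"
    unfolding saturated_def
  proof
    show "\<tau> ` torsion J \<Gamma> \<subseteq> carrier T"
      by (auto simp: torsion_\<Gamma> \<tau>_q \<rho>'(1))
    show "carrier T \<subseteq> \<tau> ` torsion J \<Gamma>"
    proof
      fix t assume t: "t \<in> carrier T"
      obtain p where p: "p \<in> N" "g p = \<zero>\<^bsub>M\<^esub>" "h p = t"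
        using h_surj[OF t] by blast
      then have "p \<in> D" "\<rho> p = t"
        using t M_tors'(2) by (simp_all add: D_def \<rho>_D s'(4))
      then show "t \<in> \<tau> ` torsion J \<Gamma>"
        using D_C by (auto simp: torsion_\<Gamma> \<tau>_q intro!: image_eqI[of _ _ "q p"])
    qed
  qed

  \<comment> \<open>A lift of m with zero \<open>T\<close>-part. Two such lifts differ by an element
    of K, so the class of the lift is independent of the choice; this is \<open>\<iota>_g\<close>,
    from which additivity and linearity of \<iota> follow.\<close>
  define gen where "gen m = (SOME p. p \<in> N \<and> g p = m \<and> h p = \<zero>\<^bsub>T\<^esub>)" for m
  have gen: "gen m \<in> N" "g (gen m) = m" "h (gen m) = \<zero>\<^bsub>T\<^esub>" if m: "m \<in> carrier M" for m
    using someI_ex[of "\<lambda>p. p \<in> N \<and> g p = m \<and> h p = \<zero>\<^bsub>T\<^esub>"] g_surj[OF m]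
    unfolding gen_def by blast+
  define \<iota> where "\<iota> m = q (gen m)" for m
  have \<iota>_g: "q p = \<iota> (g p)" if p: "p \<in> N" "h p = \<zero>\<^bsub>T\<^esub>" for p
  proof -
    note m = g'(1)[OF p(1)]
    have "h (p \<ominus>\<^bsub>P\<^esub> gen (g p)) = \<zero>\<^bsub>T\<^esub>"
      using p gen(1,3)[OF m] dom(3) by (simp add: h.hom_diff T.M.minus_eq_zero_iff)
    moreover have "g (p \<ominus>\<^bsub>P\<^esub> gen (g p)) = \<zero>\<^bsub>M\<^esub>"
      using p(1) gen(1,2)[OF m] m by (simp add: g'(5) M.M.minus_eq_zero_iff)
    ultimately have "p \<ominus>\<^bsub>P\<^esub> gen (g p) \<in> K'"
      using p(1) gen(1)[OF m] dom(6) K_K' by (auto simp: K_def)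
    then show ?thesis
      unfolding \<iota>_def using p(1) gen(1)[OF m] dom(3) by (simp add: q_eq)
  qed
  have \<iota>_hom: "\<iota> \<in> left_module_hom R M \<Gamma>"
  proof (rule left_module_homI)
    fix m m' assume m: "m \<in> carrier M" "m' \<in> carrier M"
    have "\<iota> m \<oplus>\<^bsub>\<Gamma>\<^esub> \<iota> m' = q (gen m \<oplus>\<^bsub>P\<^esub> gen m')"
      using m gen(1) dom(3) by (simp add: \<iota>_def q.hom_add)
    also have "\<dots> = \<iota> (g (gen m \<oplus>\<^bsub>P\<^esub> gen m'))"
      using m gen(1) dom(4) by (intro \<iota>_g) (simp_all add: hs gen(3) dom(3))
    also have "\<dots> = \<iota> (m \<oplus>\<^bsub>M\<^esub> m')"
      using m by (simp add: g'(2) gen)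
    finally show "\<iota> (m \<oplus>\<^bsub>M\<^esub> m') = \<iota> m \<oplus>\<^bsub>\<Gamma>\<^esub> \<iota> m'"
      by simp
  next
    fix a m assume m: "a \<in> carrier R" "m \<in> carrier M"
    have "a \<odot>\<^bsub>\<Gamma>\<^esub> \<iota> m = q (a \<odot>\<^bsub>P\<^esub> gen m)"
      using m gen(1) dom(3) by (simp add: \<iota>_def q.hom_smult)
    also have "\<dots> = \<iota> (g (a \<odot>\<^bsub>P\<^esub> gen m))"
      using m gen(1) dom(7) by (intro \<iota>_g) (simp_all add: hs gen(3) dom(3) T.smult_r_null)
    also have "\<dots> = \<iota> (a \<odot>\<^bsub>M\<^esub> m)"
      using m by (simp add: g'(3) gen)
    finally show "\<iota> (a \<odot>\<^bsub>M\<^esub> m) = a \<odot>\<^bsub>\<Gamma>\<^esub> \<iota> m"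
      by simp
  qed (use gen(1) dom(3) in \<open>simp add: \<iota>_def q.hom_closed\<close>)
  interpret \<iota>: left_module_homomorphism R M \<Gamma> \<iota>
    using M.left_module_axioms \<Gamma> \<iota>_hom
    by (simp add: left_module_homomorphism_def left_module_homomorphism_axioms_def)
  have gen_D: "gen m \<in> D" "\<rho> (gen m) = s m" if m: "m \<in> torsion J M" for m
    using m M_tors'(3)[OF m] gen[of m] by (simp_all add: D_def \<rho>_D s'(1))
  have \<tau>_\<iota>: "\<tau> (\<iota> m) = s m" if "m \<in> torsion J M" for m
    using gen_D[OF that] D_C by (auto simp: \<iota>_def \<tau>_q)
  \<comment> \<open>If \<iota> m = 0, the lift of m lies in K', hence in C, and so m is torsion. On
    such lifts \<rho> agrees with s, which is injective.\<close>
  have "inj_on \<iota> (carrier M)"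
    unfolding \<iota>.inj_on_iff_kernel
  proof (intro ballI impI)
    fix m assume m: "m \<in> carrier M" and "\<iota> m = \<zero>\<^bsub>\<Gamma>\<^esub>"
    then have gK: "gen m \<in> K'"
      using gen(1) dom(3) q_zero by (simp add: \<iota>_def)
    then obtain I where I: "I \<in> J" "\<forall>a\<in>I. a \<odot>\<^bsub>P\<^esub> gen m \<in> K"
      by (auto simp: K'_def C_def colon_iff)
    have "a \<odot>\<^bsub>M\<^esub> m = \<zero>\<^bsub>M\<^esub>" if a: "a \<in> I" for a
    proof -
      have "g (a \<odot>\<^bsub>P\<^esub> gen m) = \<zero>\<^bsub>M\<^esub>"
        using I(2) a by (simp add: K_def)
      then show ?thesis
        using filter_carrier[OF I(1) a] gen[OF m] by (simp add: g'(3))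
    qed
    then have t: "m \<in> torsion J M"
      using m I(1) by (auto simp: torsion_iff)
    then have "s m = s \<zero>\<^bsub>M\<^esub>"
      using gK gen_D(2) s'(4) by (simp add: K'_def)
    from s(2) this t M_tors'(2) show "m = \<zero>\<^bsub>M\<^esub>"
      by (rule inj_onD)
  qed
  moreover have "colon J \<Gamma> (\<iota> ` carrier M) = carrier \<Gamma>"
  proof
    show "carrier \<Gamma> \<subseteq> colon J \<Gamma> (\<iota> ` carrier M)"
    proof
      fix u assume "u \<in> carrier \<Gamma>"
      then obtain p where p: "p \<in> carrier P" "u = q p"
        by (auto simp: \<Gamma>_carrier)
      obtain I where I: "I \<in> J" "\<And>a. a \<in> I \<Longrightarrow> a \<odot>\<^bsub>P\<^esub> p \<in> N \<and> h (a \<odot>\<^bsub>P\<^esub> p) = \<zero>\<^bsub>T\<^esub>"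
        using absorb[OF p(1)] by blast
      have "a \<odot>\<^bsub>\<Gamma>\<^esub> u \<in> \<iota> ` carrier M" if a: "a \<in> I" for a
      proof -
        have "q (a \<odot>\<^bsub>P\<^esub> p) \<in> \<iota> ` carrier M"
          using I(2)[OF a] \<iota>_g g'(1) by auto
        then show ?thesis
          using p filter_carrier[OF I(1) a] by (simp add: q.hom_smult)
      qed
      then show "u \<in> colon J \<Gamma> (\<iota> ` carrier M)"
        using I(1) p q.hom_closed by (auto simp: colon_iff)
    qed
  qed (auto simp: colon_iff)
  ultimately have ext: "JT_extension R J T M s \<Gamma> \<iota> \<tau>"
    using M.left_module_axioms \<Gamma> \<iota>_hom \<tau> \<tau>_inj \<tau>_\<iota>
    by (simp add: JT_extension_def pointed_module_def pointed_map_def J_extension_def)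
  have "baer R J \<Gamma>"
  proof (rule baer_if_saturated[OF T.left_module_axioms T_baer ext sat])
    fix L f I
    assume L: "submodule L R (regular_module R)" and "I \<in> J" "I \<subseteq> L"
      and "f \<in> left_module_hom R (regular_module R\<lparr>carrier := L\<rparr>) M"
    then obtain e where e: "e \<in> carrier P"
      "\<And>l. l \<in> L \<Longrightarrow> l \<odot>\<^bsub>P\<^esub> e \<in> N \<and> g (l \<odot>\<^bsub>P\<^esub> e) = f l \<and> h (l \<odot>\<^bsub>P\<^esub> e) = \<zero>\<^bsub>T\<^esub>"
      using solve by blast
    have "\<iota> (f l) = l \<odot>\<^bsub>\<Gamma>\<^esub> q e" if l: "l \<in> L" for l
    proof -
      have "l \<in> carrier R"
        using left_module.left_submoduleD(3)[OF left_module_regular[OF ring_axioms] L l] by simp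
      then show ?thesis
        using \<iota>_g[of "l \<odot>\<^bsub>P\<^esub> e"] e(1) e(2)[OF l] by (simp add: q.hom_smult)
    qed
    then show "\<exists>g\<in>carrier \<Gamma>. \<forall>l\<in>L. \<iota> (f l) = l \<odot>\<^bsub>\<Gamma>\<^esub> g"
      using q.hom_closed[OF e(1)] by blast
  qed
  with ext sat show thesis
    by (rule that)
qed

end

text \<open>The data are \<open>cover\<close>, \<open>glue_dom\<close>, \<open>glue\<close> and the
  projection \<open>snd\<close> to \<open>T\<close>. The generator of (L, f) solves f because its
  multiple by l in L has the single coefficient l, which \<open>glue\<close> evaluates to f
  l.\<close>

lemma (in pointed_module_setting) saturated_baer_extension:
  obtains \<Gamma> :: "('r, (('r set \<times> ('r \<Rightarrow> 'm) \<Rightarrow> 'r) \<times> 't) set) module" and \<iota> \<tau>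
  where "JT_extension R J T M s \<Gamma> \<iota> \<tau>" "saturated J T \<Gamma> \<tau>" "baer R J \<Gamma>"
proof (rule saturated_baer_extension_from_cover[OF cover_module glue_dom_submodule glue_hom])
  have single: "\<exists>e\<in>carrier cover. \<forall>l\<in>L. l \<odot>\<^bsub>cover\<^esub> e \<in> glue_dom \<and> glue (l \<odot>\<^bsub>cover\<^esub> e) = f l \<and>
    snd (l \<odot>\<^bsub>cover\<^esub> e) = \<zero>\<^bsub>T\<^esub>" if y: "(L, f) \<in> gens" for L f
  proof -
    define e where "e r = ((\<lambda>z. if z = (L, f) then r else \<zero>), \<zero>\<^bsub>T\<^esub>)" for r
    have e: "e l \<in> glue_dom" "glue (e l) = f l" "snd (e l) = \<zero>\<^bsub>T\<^esub>" if "l \<in> L" for l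
      using glue_single[OF y, of l] that by (simp_all add: e_def)
    have "{z. fst (e \<one>) z \<noteq> \<zero>} \<subseteq> {(L, f)}"
      by (auto simp: e_def)
    then have "finite {z. fst (e \<one>) z \<noteq> \<zero>}" "{z. fst (e \<one>) z \<noteq> \<zero>} \<subseteq> gens"
      using y by (auto intro: finite_subset)
    then have e1: "e \<one> \<in> carrier cover"
      unfolding cover_carrier by (simp add: e_def)
    have "e l = l \<odot>\<^bsub>cover\<^esub> e \<one>" if l: "l \<in> L" for l
      using gens_submodule(3)[OF y] l by (auto simp: e_def cover_simps T.smult_r_null)
    then show ?thesis
      using e e1 by (intro bexI[of _ "e \<one>"]) simp_all
  qed
  show "snd \<in> left_module_hom R cover T"
    by (rule left_module_homI) (simp_all add: coverD cover_simps)
  show "\<exists>e\<in>carrier cover. \<forall>l\<in>L. l \<odot>\<^bsub>cover\<^esub> e \<in> glue_dom \<and> glue (l \<odot>\<^bsub>cover\<^esub> e) = f l \<and>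
    snd (l \<odot>\<^bsub>cover\<^esub> e) = \<zero>\<^bsub>T\<^esub>"
    if "submodule L R (regular_module R)" "I \<in> J" "I \<subseteq> L"
      "f \<in> left_module_hom R (regular_module R\<lparr>carrier := L\<rparr>) M" for L f I
    using that by (intro single) (auto simp: gens_def)
  \<comment> \<open>The cover contains no separate summand \<open>M\<close>: an element m is reached
    through the problem r |-> r m on the left ideal R, evaluated at 1.\<close>
  show "\<exists>p\<in>glue_dom. glue p = m \<and> snd p = \<zero>\<^bsub>T\<^esub>" if m: "m \<in> carrier M" for m
  proof -
    have "(\<lambda>r. r \<odot>\<^bsub>M\<^esub> m) \<in> left_module_hom R (regular_module R\<lparr>carrier := carrier R\<rparr>) M"
      using m by (intro left_module_homI) (auto simp: M.smult_closed M.smult_l_distr M.smult_assoc1)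
    moreover have "\<exists>I\<in>J. I \<subseteq> carrier R"
      by (rule filter_nonempty) (use filter_carrier in blast)
    moreover have "submodule (carrier R) R (regular_module R)"
      using left_module.left_submodule_carrier[OF left_module_regular[OF ring_axioms]] by simp
    ultimately have "(carrier R, \<lambda>r. r \<odot>\<^bsub>M\<^esub> m) \<in> gens"
      by (simp add: gens_def)
    then obtain e where "\<forall>l\<in>carrier R. l \<odot>\<^bsub>cover\<^esub> e \<in> glue_dom \<and> glue (l \<odot>\<^bsub>cover\<^esub> e) = l \<odot>\<^bsub>M\<^esub> m \<and>
        snd (l \<odot>\<^bsub>cover\<^esub> e) = \<zero>\<^bsub>T\<^esub>"
      using single by blast
    from bspec[OF this one_closed] show ?thesis
      using m by (auto simp only: M.smult_one)
  qed
  show "\<exists>p\<in>glue_dom. glue p = \<zero>\<^bsub>M\<^esub> \<and> snd p = t" if "t \<in> carrier T" for t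
    using that gens_submodule(2)
    by (intro bexI[of _ "(\<lambda>y. \<zero>, t)"])
      (simp_all add: glue_dom_def cover_carrier glue_def M.finsum_empty)
  show "\<exists>I\<in>J. \<forall>a\<in>I. a \<odot>\<^bsub>cover\<^esub> p \<in> glue_dom \<and> snd (a \<odot>\<^bsub>cover\<^esub> p) = \<zero>\<^bsub>T\<^esub>"
    if p: "p \<in> carrier cover" for p
  proof -
    have "snd p \<in> torsion J T"
      using T_torsion coverD(2)[OF p] by (simp add: is_torsion_def)
    then obtain I where I: "I \<in> J" "\<forall>a\<in>I. a \<odot>\<^bsub>T\<^esub> snd p = \<zero>\<^bsub>T\<^esub>"
      by (auto simp: torsion_iff)
    \<comment> \<open>As the support is finite, one I' in \<open>J\<close> lies in the left ideals
      of all its generators. Being a right ideal, I' multiplies each coefficient into the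
      corresponding left ideal; intersecting with I also kills the \<open>T\<close>-part.\<close>
    have "finite {y. fst p y \<noteq> \<zero>}" "{y. fst p y \<noteq> \<zero>} \<subseteq> gens"
      using p by (simp_all add: cover_carrier)
    then have "\<exists>I\<in>J. \<forall>y\<in>{y. fst p y \<noteq> \<zero>}. I \<subseteq> fst y"
    proof (induction rule: finite_induct)
      case empty
      show ?case
        using I(1) by auto
    next
      case (insert y A)
      then obtain I1 I2 where "I1 \<in> J" "\<forall>y\<in>A. I1 \<subseteq> fst y" "I2 \<in> J" "I2 \<subseteq> fst y"
        using gensD(2)[of y] by blast
      then show ?case
        using filter_Int[of I1 I2] by (intro bexI[of _ "I1 \<inter> I2"]) auto
    qed
    then obtain I' where I': "I' \<in> J" "\<And>y. fst p y \<noteq> \<zero> \<Longrightarrow> I' \<subseteq> fst y"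
      by blast
    have "a \<odot>\<^bsub>cover\<^esub> p \<in> glue_dom \<and> snd (a \<odot>\<^bsub>cover\<^esub> p) = \<zero>\<^bsub>T\<^esub>" if a: "a \<in> I \<inter> I'" for a
    proof -
      have aR: "a \<in> carrier R"
        using filter_carrier I(1) a by blast
      have "a \<otimes> fst p y \<in> fst y" if "y \<in> gens" for y
      proof (cases "fst p y = \<zero>")
        case True
        then show ?thesis
          using gens_submodule(2)[OF that] aR by simp
      next
        case False
        then show ?thesis
          using I'(2)[of y] filter_r_closed[OF I'(1)] a coverD(1)[OF p] by blast
      qed
      then show ?thesis
        using cover_smult_closed[OF aR p] I(2) a by (simp add: glue_dom_def cover_simps)
    qed
    then show ?thesis
      using filter_Int[OF I(1) I'(1)] by blast
  qed
qed (rule that)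

section \<open>Maps of extensions\<close>

lemma JT_extensionD:
  assumes "JT_extension R J T M s N i t"
  shows "left_module_homomorphism R M N i" "inj_on i (carrier M)"
    "colon J N (i ` carrier M) = carrier N"
    "t \<in> left_module_hom R (N\<lparr>carrier := torsion J N\<rparr>) T" "inj_on t (torsion J N)"
    "\<And>x. x \<in> torsion J M \<Longrightarrow> t (i x) = s x"
    "\<And>x. x \<in> carrier N \<Longrightarrow> \<exists>I\<in>J. \<forall>a\<in>I. a \<odot>\<^bsub>N\<^esub> x \<in> i ` carrier M"
proof -
  show "left_module_homomorphism R M N i" "inj_on i (carrier M)"
    and colon: "colon J N (i ` carrier M) = carrier N"
    and "t \<in> left_module_hom R (N\<lparr>carrier := torsion J N\<rparr>) T" "inj_on t (torsion J N)"
    and "\<And>x. x \<in> torsion J M \<Longrightarrow> t (i x) = s x"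
    using assms
    by (simp_all add: JT_extension_def J_extension_def pointed_module_def pointed_map_def
        left_module_homomorphism_def left_module_homomorphism_axioms_def)
  fix x assume "x \<in> carrier N"
  then have "x \<in> colon J N (i ` carrier M)"
    unfolding colon .
  then show "\<exists>I\<in>J. \<forall>a\<in>I. a \<odot>\<^bsub>N\<^esub> x \<in> i ` carrier M"
    unfolding colon_def by blast
qed

lemma JT_mapD:
  assumes "JT_map R J M N i t P j u f" "left_module R N" "left_module R P"
  shows "left_module_homomorphism R N P f"
    "\<And>x. x \<in> torsion J N \<Longrightarrow> u (f x) = t x" "\<And>x. x \<in> carrier M \<Longrightarrow> f (i x) = j x"
  using assms
  by (simp_all add: JT_map_def pointed_map_def
      left_module_homomorphism_def left_module_homomorphism_axioms_def)

lemma (in left_module_homomorphism) hom_torsion: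
  assumes "filtered_ring R J" "x \<in> torsion J A" shows "f x \<in> torsion J B"
proof -
  interpret filtered_ring R J by fact
  obtain I where I: "x \<in> carrier A" "I \<in> J" "\<forall>a\<in>I. a \<odot>\<^bsub>A\<^esub> x = \<zero>\<^bsub>A\<^esub>"
    using assms(2) by (auto simp: torsion_iff)
  then have "\<forall>a\<in>I. a \<odot>\<^bsub>B\<^esub> f x = \<zero>\<^bsub>B\<^esub>"
    using hom_zero filter_carrier[OF I(2)] by (simp flip: hom_smult)
  then show ?thesis
    using I hom_closed by (auto simp: torsion_iff)
qed

lemma (in left_module_homomorphism) torsion_reflect:
  assumes "filtered_ring R J" "inj_on f (carrier A)" "x \<in> carrier A" "f x \<in> torsion J B"
  shows "x \<in> torsion J A"
proof -
  interpret filtered_ring R J by fact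
  obtain I where I: "I \<in> J" "\<forall>a\<in>I. a \<odot>\<^bsub>B\<^esub> f x = \<zero>\<^bsub>B\<^esub>"
    using assms(4) by (auto simp: torsion_iff)
  have "a \<odot>\<^bsub>A\<^esub> x = \<zero>\<^bsub>A\<^esub>" if a: "a \<in> I" for a
  proof -
    have "a \<in> carrier R"
      using filter_carrier I(1) a .
    then show ?thesis
      using assms(2,3) I(2) a A.smult_closed[of a x] unfolding inj_on_iff_kernel
      by (simp add: hom_smult)
  qed
  then show ?thesis
    using I(1) assms(3) by (auto simp: torsion_iff)
qed

lemma (in left_module_homomorphism) baer_iso:
  assumes "filtered_ring R J" "bij_betw f (carrier A) (carrier B)" "baer R J A"
  shows "baer R J B"
  unfolding baer_def
proof (intro allI impI, elim conjE)
  fix L h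
  assume L: "submodule L R (regular_module R)" and I: "\<exists>I\<in>J. I \<subseteq> L"
    and h: "h \<in> left_module_hom R (regular_module R\<lparr>carrier := L\<rparr>) B"
  define k where "k = inv_into (carrier A) f"
  have inj: "inj_on f (carrier A)" and im: "f ` carrier A = carrier B"
    using assms(2) by (simp_all add: bij_betw_def)
  have k: "k y \<in> carrier A" "f (k y) = y" if "y \<in> carrier B" for y
    using that im by (auto simp: k_def inv_into_into f_inv_into_f)
  have k_hom: "k \<in> left_module_hom R B A"
    by (rule left_module_homI)
      (auto intro!: inj_onD[OF inj] simp: k A.smult_closed B.smult_closed hom_add hom_smult)
  obtain q where q: "q \<in> carrier A" "\<forall>l\<in>L. (k \<circ> h) l = l \<odot>\<^bsub>A\<^esub> q"
    using assms(3) L I left_module_hom_compose[OF h k_hom] unfolding baer_def by blast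
  have "h l = l \<odot>\<^bsub>B\<^esub> f q" if l: "l \<in> L" for l
  proof -
    have "h l = f (k (h l))"
      using left_module_homD(1)[OF h] l k(2) by simp
    also have "\<dots> = f (l \<odot>\<^bsub>A\<^esub> q)"
      using q(2) l by simp
    also have "\<dots> = l \<odot>\<^bsub>B\<^esub> f q"
      using q(1) left_module.left_submoduleD(3)[OF left_module_regular[OF A.R.ring_axioms] L l]
      by (simp add: hom_smult)
    finally show ?thesis .
  qed
  then show "\<exists>q\<in>carrier B. \<forall>l\<in>L. h l = l \<odot>\<^bsub>B\<^esub> q"
    using hom_closed[OF q(1)] by blast
qed

section \<open>Moving extensions between types, and comparing them\<close>

context filtered_ring
begin

text \<open>An element \<open>x\<close> is coded by an \<open>I \<in> J\<close> with \<open>I x \<subseteq> i M\<close>, the function \<open>a \<mapsto> i\<inverse>(a x)\<close> on \<open>I\<close>, and the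
  image in \<open>T\<close> of the difference to a chosen element with the same \<open>I\<close> and function.\<close>

lemma JT_extension_code:
  fixes N :: "('r, 'n, 'y) module_scheme" and M :: "('r, 'm, 'x) module_scheme"
    and t :: "'n \<Rightarrow> 't"
  assumes ext: "JT_extension R J T M s N i t"
  obtains e :: "'n \<Rightarrow> ('r, 'm, 't) univ" where "inj_on e (carrier N)"
proof -
  note N = JT_extensionD[OF ext]
  interpret i: left_module_homomorphism R M N i
    by (rule N(1))
  define I where "I x = (SOME I. I \<in> J \<and> (\<forall>a\<in>I. a \<odot>\<^bsub>N\<^esub> x \<in> i ` carrier M))" for x
  have I: "I x \<in> J" "\<And>a. a \<in> I x \<Longrightarrow> a \<odot>\<^bsub>N\<^esub> x \<in> i ` carrier M" if "x \<in> carrier N" for x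
  proof -
    have "\<exists>I. I \<in> J \<and> (\<forall>a\<in>I. a \<odot>\<^bsub>N\<^esub> x \<in> i ` carrier M)"
      using N(7)[OF that] by blast
    from someI_ex[OF this] show "I x \<in> J" "\<And>a. a \<in> I x \<Longrightarrow> a \<odot>\<^bsub>N\<^esub> x \<in> i ` carrier M"
      by (simp_all add: I_def)
  qed
  define key :: "'n \<Rightarrow> ('r, 'm, 't) univ" where
    "key x = (\<lambda>a. (0, a, inv_into (carrier M) i (a \<odot>\<^bsub>N\<^esub> x), undefined)) ` I x" for x
  \<comment> \<open>The choice depends on the key alone, so elements with equal keys get the same
    base point and their \<open>T\<close>-coordinates can be compared.\<close>
  define base where "base x = (SOME y. y \<in> carrier N \<and> key y = key x)" for x
  have base: "base x \<in> carrier N" "key (base x) = key x" if "x \<in> carrier N" for x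
    using someI[of "\<lambda>y. y \<in> carrier N \<and> key y = key x" x] that by (simp_all add: base_def)
  have key_torsion: "x \<ominus>\<^bsub>N\<^esub> y \<in> torsion J N"
    if xy: "x \<in> carrier N" "y \<in> carrier N" "key x = key y" for x y
  proof -
    have "a \<odot>\<^bsub>N\<^esub> (x \<ominus>\<^bsub>N\<^esub> y) = \<zero>\<^bsub>N\<^esub>" if a: "a \<in> I x" for a
    proof -
      have aR: "a \<in> carrier R"
        using filter_carrier I(1)[OF xy(1)] a .
      have "(0, a, inv_into (carrier M) i (a \<odot>\<^bsub>N\<^esub> x), undefined) \<in> key y"
        unfolding xy(3)[symmetric] using a by (auto simp: key_def)
      then have "a \<in> I y" "inv_into (carrier M) i (a \<odot>\<^bsub>N\<^esub> x) = inv_into (carrier M) i (a \<odot>\<^bsub>N\<^esub> y)"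
        by (auto simp: key_def)
      then have "a \<odot>\<^bsub>N\<^esub> x = a \<odot>\<^bsub>N\<^esub> y"
        using I(2)[OF xy(1) a] I(2)[OF xy(2)] inv_into_injective by metis
      then show ?thesis
        using aR xy by (simp add: i.B.smult_r_diff i.B.smult_closed i.B.M.minus_eq_zero_iff)
    qed
    then show ?thesis
      using I(1)[OF xy(1)] xy by (auto simp: torsion_iff)
  qed
  define e where "e x = key x \<union> {(1, undefined, undefined, t (x \<ominus>\<^bsub>N\<^esub> base x))}" for x
  have "inj_on e (carrier N)"
  proof (rule inj_onI)
    fix x y assume xy: "x \<in> carrier N" "y \<in> carrier N" "e x = e y"
    have key: "key z = e z \<inter> {p. fst p = 0}" for z
      by (auto simp: e_def key_def)
    then have kxy: "key x = key y"
      using xy(3) by simp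
    then have b: "base x = base y"
      by (simp add: base_def)
    have "(1, undefined, undefined, t (x \<ominus>\<^bsub>N\<^esub> base x)) \<in> e y"
      unfolding xy(3)[symmetric] by (simp add: e_def)
    then have "t (x \<ominus>\<^bsub>N\<^esub> base x) = t (y \<ominus>\<^bsub>N\<^esub> base x)"
      by (auto simp: e_def key_def b)
    then have "x \<ominus>\<^bsub>N\<^esub> base x = y \<ominus>\<^bsub>N\<^esub> base x"
      using N(5) key_torsion xy base kxy by (auto dest!: inj_onD)
    then have "base x \<oplus>\<^bsub>N\<^esub> (x \<ominus>\<^bsub>N\<^esub> base x) = base x \<oplus>\<^bsub>N\<^esub> (y \<ominus>\<^bsub>N\<^esub> base x)"
      by simp
    then show "x = y"
      using xy base(1)[OF xy(1)] by (simp add: i.B.M.add_minus_cancel)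
  qed
  then show thesis
    by (rule that)
qed

text \<open>Transport of structure along a bijection of carriers. It serves to bring the constructed
  extension, which lives on a type of cosets, into \<open>univ\<close>.\<close>

lemma saturated_baer_copy:
  fixes N :: "('r, 'n, 'y) module_scheme" and e :: "'n \<Rightarrow> 'q"
  assumes T: "left_module R T"
    and ext: "JT_extension R J T M s N i t" "saturated J T N t" "baer R J N"
    and e: "inj_on e (carrier N)"
  obtains N' :: "('r, 'q) module" and i' t'
  where "JT_extension R J T M s N' i' t'" "saturated J T N' t'" "baer R J N'"
proof -
  note N = JT_extensionD[OF ext(1)]
  interpret i: left_module_homomorphism R M N i
    by (rule N(1))
  define N' where "N' = image_module N e"
  have N': "left_module R N'" "e \<in> left_module_hom R N N'" "carrier N' = e ` carrier N"
    using copy_module[OF i.B.left_module_axioms e] by (simp_all add: N'_def)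
  interpret e: left_module_homomorphism R N N' e
    using i.B.left_module_axioms N'(1,2)
    by (simp add: left_module_homomorphism_def left_module_homomorphism_axioms_def)
  have tors: "submodule (torsion J N) R N"
    by (rule torsion_submodule) (rule i.B.left_module_axioms)
  note tors' = i.B.left_submoduleD[OF tors]
  note t = i.B.submodule_hom[OF T tors N(4)]
  have "torsion J N' \<subseteq> e ` carrier N"
    unfolding N'(3)[symmetric] by (auto simp: torsion_iff)
  then have torsion_N': "torsion J N' = e ` torsion J N"
    using e.hom_torsion[OF filtered_ring_axioms] e.torsion_reflect[OF filtered_ring_axioms e]
    by blast
  define t' where "t' = t \<circ> inv_into (carrier N) e"
  have t'e: "t' (e x) = t x" if "x \<in> carrier N" for x
    using that e by (simp add: t'_def)
  have "t' \<in> left_module_hom R (N'\<lparr>carrier := torsion J N'\<rparr>) T"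
    by (rule left_module_homI)
      (auto simp: torsion_N' t'e t tors'(3,4,7) simp flip: e.hom_add e.hom_smult)
  moreover have "inj_on t' (torsion J N')"
    using N(5) tors'(3) by (auto simp: torsion_N' t'e inj_on_def)
  moreover have "e \<circ> i \<in> left_module_hom R M N'"
    using i.hom e.hom by (rule left_module_hom_compose)
  moreover have "inj_on (e \<circ> i) (carrier M)"
    using N(2) e i.hom_closed by (auto simp: inj_on_def)
  moreover have "colon J N' ((e \<circ> i) ` carrier M) = carrier N'"
  proof
    show "carrier N' \<subseteq> colon J N' ((e \<circ> i) ` carrier M)"
    proof
      fix y assume "y \<in> carrier N'"
      then obtain x where x: "x \<in> carrier N" "y = e x"
        by (auto simp: N'(3))
      then obtain I where I: "I \<in> J" "\<And>a. a \<in> I \<Longrightarrow> a \<odot>\<^bsub>N\<^esub> x \<in> i ` carrier M"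
        using N(7) by blast
      have "a \<odot>\<^bsub>N'\<^esub> y \<in> (e \<circ> i) ` carrier M" if a: "a \<in> I" for a
        using I(2)[OF a] x filter_carrier[OF I(1) a]
        unfolding image_comp[symmetric] by (simp flip: e.hom_smult)
      then show "y \<in> colon J N' ((e \<circ> i) ` carrier M)"
        using I(1) x N'(3) unfolding colon_iff by blast
    qed
  qed (auto simp: colon_iff)
  moreover have "t' ((e \<circ> i) x) = s x" if "x \<in> torsion J M" for x
    using that N(6) i.hom_closed by (simp add: t'e torsion_iff)
  ultimately have "JT_extension R J T M s N' (e \<circ> i) t'"
    using i.A.left_module_axioms N'(1)
    by (simp add: JT_extension_def J_extension_def pointed_module_def pointed_map_def)
  moreover have "saturated J T N' t'"
    using ext(2) tors'(3) by (auto simp: saturated_def torsion_N' image_image t'e cong: image_cong)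
  moreover have "baer R J N'"
    by (rule e.baer_iso[OF filtered_ring_axioms _ ext(3)]) (simp add: bij_betw_def e N'(3))
  ultimately show thesis
    by (rule that)
qed

text \<open>Compatibility with the maps to \<open>T\<close> forces the value \<tau>^-1 (t n) at
  torsion elements n, and saturation makes it available. Extending from i(M) alone would not control
  these values, so i(M) + N[J] is used as the domain; its colon is still all of N.\<close>

lemma JT_map_to_saturated_baer:
  assumes T: "left_module R T"
    and \<Gamma>: "JT_extension R J T M s \<Gamma> \<iota> \<tau>" "saturated J T \<Gamma> \<tau>" "baer R J \<Gamma>"
    and N: "JT_extension R J T M s N i t"
  obtains f where "JT_map R J M N i t \<Gamma> \<iota> \<tau> f"
proof -
  note \<Gamma>' = JT_extensionD[OF \<Gamma>(1)] and N' = JT_extensionD[OF N]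
  interpret i: left_module_homomorphism R M N i
    by (rule N'(1))
  interpret \<iota>: left_module_homomorphism R M \<Gamma> \<iota>
    by (rule \<Gamma>'(1))
  have torsN: "submodule (torsion J N) R N" and tors\<Gamma>: "submodule (torsion J \<Gamma>) R \<Gamma>"
    by (rule torsion_submodule, rule i.B.left_module_axioms)
      (rule torsion_submodule, rule \<iota>.B.left_module_axioms)
  note torsN' = i.B.left_submoduleD[OF torsN] and tors\<Gamma>' = \<iota>.B.left_submoduleD[OF tors\<Gamma>]
  note t = i.B.submodule_hom[OF T torsN N'(4)] and \<tau> = \<iota>.B.submodule_hom[OF T tors\<Gamma> \<Gamma>'(4)]
  define \<sigma> where "\<sigma> = inv_into (torsion J \<Gamma>) \<tau>"
  have \<sigma>: "\<sigma> (t n) \<in> torsion J \<Gamma>" "\<tau> (\<sigma> (t n)) = t n" if "n \<in> torsion J N" for n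
    using \<Gamma>(2) t(1)[OF that] unfolding saturated_def \<sigma>_def
    by (auto intro: inv_into_into f_inv_into_f)
  define k where "k n = \<sigma> (t n)" for n
  have k: "k n \<in> torsion J \<Gamma>" "k n \<in> carrier \<Gamma>" "\<tau> (k n) = t n" if "n \<in> torsion J N" for n
    using \<sigma>[OF that] tors\<Gamma>'(3) by (auto simp: k_def)
  have k_eq: "k n = u" if "n \<in> torsion J N" "u \<in> torsion J \<Gamma>" "\<tau> u = t n" for n u
    using inj_onD[OF \<Gamma>'(5)] k that by metis
  have k_add: "k (n \<oplus>\<^bsub>N\<^esub> n') = k n \<oplus>\<^bsub>\<Gamma>\<^esub> k n'" if "n \<in> torsion J N" "n' \<in> torsion J N" for n n'
    using that by (intro k_eq) (simp_all add: torsN'(4) tors\<Gamma>'(4) k \<tau>(2) t(2))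
  have k_smult: "k (a \<odot>\<^bsub>N\<^esub> n) = a \<odot>\<^bsub>\<Gamma>\<^esub> k n" if "a \<in> carrier R" "n \<in> torsion J N" for a n
    using that by (intro k_eq) (simp_all add: torsN'(7) tors\<Gamma>'(7) k \<tau>(3) t(3))
  have k_zero: "k \<zero>\<^bsub>N\<^esub> = \<zero>\<^bsub>\<Gamma>\<^esub>"
    by (intro k_eq) (simp_all add: torsN'(2) tors\<Gamma>'(2) \<tau>(4) t(4))
  have k_i: "k (i m) = \<iota> m" if m: "m \<in> torsion J M" for m
    using i.hom_torsion[OF filtered_ring_axioms m] \<iota>.hom_torsion[OF filtered_ring_axioms m]
      \<Gamma>'(6)[OF m] N'(6)[OF m] by (intro k_eq) simp_all
  \<comment> \<open>The difference d = m - m' has torsion image in N, so d is torsion because i is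
    injective. On torsion of \<open>M\<close> the two prescriptions agree, as both i and \<iota>
    respect s (\<open>k_i\<close>).\<close>
  have unique: "\<iota> m \<oplus>\<^bsub>\<Gamma>\<^esub> k n = \<iota> m' \<oplus>\<^bsub>\<Gamma>\<^esub> k n'"
    if m: "m \<in> carrier M" "m' \<in> carrier M" and n: "n \<in> torsion J N" "n' \<in> torsion J N"
      and eq: "i m \<oplus>\<^bsub>N\<^esub> n = i m' \<oplus>\<^bsub>N\<^esub> n'" for m m' n n'
  proof -
    note [simp] = m i.hom_closed \<iota>.hom_closed torsN'(3)[OF n(1)] torsN'(3)[OF n(2)] k(2)[OF n(1)] k(2)[OF n(2)]
    define d where "d = m \<ominus>\<^bsub>M\<^esub> m'"
    have d: "d \<in> carrier M" "m = m' \<oplus>\<^bsub>M\<^esub> d"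
      by (simp_all add: d_def i.A.M.add_minus_cancel)
    have "i m' \<oplus>\<^bsub>N\<^esub> (i d \<oplus>\<^bsub>N\<^esub> n) = i m' \<oplus>\<^bsub>N\<^esub> n'"
      using eq d(1) by (simp add: d(2) i.hom_add i.B.M.a_assoc)
    then have n': "i d \<oplus>\<^bsub>N\<^esub> n = n'"
      using d(1) by (simp add: i.B.M.add.l_cancel)
    then have "i d = n' \<ominus>\<^bsub>N\<^esub> n"
      using d(1) by (auto simp: a_minus_def i.B.M.a_assoc i.B.M.r_neg)
    then have id: "i d \<in> torsion J N"
      using torsN'(6) n by simp
    then have dt: "d \<in> torsion J M"
      using i.torsion_reflect[OF filtered_ring_axioms N'(2)] d(1) by blast
    have "k n' = \<iota> d \<oplus>\<^bsub>\<Gamma>\<^esub> k n"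
      using k_add[OF id n(1)] n' k_i[OF dt] by simp
    then show ?thesis
      using d(1) by (simp add: d(2) \<iota>.hom_add \<iota>.B.M.a_assoc)
  qed
  define A where "A = {i m \<oplus>\<^bsub>N\<^esub> n | m n. m \<in> carrier M \<and> n \<in> torsion J N}"
  define f0 where "f0 x = (THE u. \<exists>m\<in>carrier M. \<exists>n\<in>torsion J N. x = i m \<oplus>\<^bsub>N\<^esub> n \<and> u = \<iota> m \<oplus>\<^bsub>\<Gamma>\<^esub> k n)" for x
  have f0: "f0 (i m \<oplus>\<^bsub>N\<^esub> n) = \<iota> m \<oplus>\<^bsub>\<Gamma>\<^esub> k n" if "m \<in> carrier M" "n \<in> torsion J N" for m n
    unfolding f0_def
  proof (rule the_equality)
    fix u assume "\<exists>m'\<in>carrier M. \<exists>n'\<in>torsion J N.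
      i m \<oplus>\<^bsub>N\<^esub> n = i m' \<oplus>\<^bsub>N\<^esub> n' \<and> u = \<iota> m' \<oplus>\<^bsub>\<Gamma>\<^esub> k n'"
    then obtain m' n' where *: "m' \<in> carrier M" "n' \<in> torsion J N"
      "i m \<oplus>\<^bsub>N\<^esub> n = i m' \<oplus>\<^bsub>N\<^esub> n'" "u = \<iota> m' \<oplus>\<^bsub>\<Gamma>\<^esub> k n'"
      by blast
    then show "u = \<iota> m \<oplus>\<^bsub>\<Gamma>\<^esub> k n"
      using unique[OF that(1) *(1) that(2) *(2,3)] by simp
  qed (use that in blast)
  have A_add: "i m \<oplus>\<^bsub>N\<^esub> n \<oplus>\<^bsub>N\<^esub> (i m' \<oplus>\<^bsub>N\<^esub> n') = i (m \<oplus>\<^bsub>M\<^esub> m') \<oplus>\<^bsub>N\<^esub> (n \<oplus>\<^bsub>N\<^esub> n')"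
    if "m \<in> carrier M" "m' \<in> carrier M" "n \<in> torsion J N" "n' \<in> torsion J N" for m m' n n'
    using that torsN'(3) by (simp add: i.hom_add i.hom_closed i.B.M.a_ac)
  have A_smult: "a \<odot>\<^bsub>N\<^esub> (i m \<oplus>\<^bsub>N\<^esub> n) = i (a \<odot>\<^bsub>M\<^esub> m) \<oplus>\<^bsub>N\<^esub> a \<odot>\<^bsub>N\<^esub> n"
    if "a \<in> carrier R" "m \<in> carrier M" "n \<in> torsion J N" for a m n
    using that torsN'(3) by (simp add: i.hom_smult i.hom_closed i.B.smult_r_distr)
  have iA: "i m \<in> A" "f0 (i m) = \<iota> m" if m: "m \<in> carrier M" for m
  proof -
    have "i m = i m \<oplus>\<^bsub>N\<^esub> \<zero>\<^bsub>N\<^esub>"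
      using m by (simp add: i.hom_closed)
    then show "i m \<in> A" "f0 (i m) = \<iota> m"
      using m f0[OF m torsN'(2)] torsN'(2) by (auto simp: A_def k_zero \<iota>.hom_closed)
  qed
  have tA: "n \<in> A" "f0 n = k n" if n: "n \<in> torsion J N" for n
  proof -
    have "n = i \<zero>\<^bsub>M\<^esub> \<oplus>\<^bsub>N\<^esub> n"
      using torsN'(3)[OF n] by (simp add: i.hom_zero)
    then show "n \<in> A" "f0 n = k n"
      using n f0[OF i.A.M.zero_closed n] k(2)[OF n] i.A.M.zero_closed
      by (auto simp: A_def \<iota>.hom_zero)
  qed
  have A: "submodule A R N"
  proof (rule i.B.left_submoduleI)
    show "A \<subseteq> carrier N"
      using torsN'(3) by (auto simp: A_def i.hom_closed)
    show "\<zero>\<^bsub>N\<^esub> \<in> A"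
      using tA torsN'(2) by blast
    show "x \<oplus>\<^bsub>N\<^esub> y \<in> A" if "x \<in> A" "y \<in> A" for x y
      using that A_add i.A.M.a_closed torsN'(4) unfolding A_def by fast
    show "a \<odot>\<^bsub>N\<^esub> x \<in> A" if "a \<in> carrier R" "x \<in> A" for a x
      using that A_smult i.A.smult_closed torsN'(7) unfolding A_def by fast
  qed
  have f0_hom: "f0 \<in> left_module_hom R (N\<lparr>carrier := A\<rparr>) \<Gamma>"
  proof (rule left_module_homI)
    fix x y assume "x \<in> carrier (N\<lparr>carrier := A\<rparr>)" "y \<in> carrier (N\<lparr>carrier := A\<rparr>)"
    then obtain m n m' n' where *: "m \<in> carrier M" "m' \<in> carrier M" "n \<in> torsion J N"
      "n' \<in> torsion J N" and xy: "x = i m \<oplus>\<^bsub>N\<^esub> n" "y = i m' \<oplus>\<^bsub>N\<^esub> n'"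
      by (auto simp: A_def)
    then have "f0 (x \<oplus>\<^bsub>N\<^esub> y) = \<iota> (m \<oplus>\<^bsub>M\<^esub> m') \<oplus>\<^bsub>\<Gamma>\<^esub> k (n \<oplus>\<^bsub>N\<^esub> n')"
      by (simp add: A_add f0 torsN'(4))
    then show "f0 (x \<oplus>\<^bsub>N\<lparr>carrier := A\<rparr>\<^esub> y) = f0 x \<oplus>\<^bsub>\<Gamma>\<^esub> f0 y"
      using * by (simp add: xy f0 k_add \<iota>.hom_add \<iota>.B.M.a_ac \<iota>.hom_closed k(2))
  next
    fix a x assume a: "a \<in> carrier R" and "x \<in> carrier (N\<lparr>carrier := A\<rparr>)"
    then obtain m n where *: "m \<in> carrier M" "n \<in> torsion J N" and x: "x = i m \<oplus>\<^bsub>N\<^esub> n"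
      by (auto simp: A_def)
    then have "f0 (a \<odot>\<^bsub>N\<^esub> x) = \<iota> (a \<odot>\<^bsub>M\<^esub> m) \<oplus>\<^bsub>\<Gamma>\<^esub> k (a \<odot>\<^bsub>N\<^esub> n)"
      using a by (simp add: A_smult f0 torsN'(7) i.A.smult_closed)
    then show "f0 (a \<odot>\<^bsub>N\<lparr>carrier := A\<rparr>\<^esub> x) = a \<odot>\<^bsub>\<Gamma>\<^esub> f0 x"
      using * a by (simp add: x f0 k_smult \<iota>.hom_smult \<iota>.hom_closed k(2) \<iota>.B.smult_r_distr)
  next
    fix x assume "x \<in> carrier (N\<lparr>carrier := A\<rparr>)"
    then show "f0 x \<in> carrier \<Gamma>"
      by (auto simp: A_def f0 \<iota>.hom_closed k(2))
  qed
  have "carrier N \<subseteq> colon J N A"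
    unfolding N'(3)[symmetric] using iA(1) by (intro colon_mono) auto
  then obtain f where f: "f \<in> left_module_hom R N \<Gamma>" "\<And>x. x \<in> A \<Longrightarrow> f x = f0 x"
    using baer_extend[OF \<Gamma>(3) \<iota>.B.left_module_axioms i.B.left_module_axioms A _ f0_hom] by metis
  show thesis
  proof (rule that)
    show "JT_map R J M N i t \<Gamma> \<iota> \<tau> f"
      unfolding JT_map_def pointed_map_def using f iA tA k(3) by auto
  qed
qed

text \<open>Since \<open>'n\<close> is arbitrary, this lemma and
  \<open>maximal_imp_saturated_baer\<close> together upgrade maximality over \<open>univ\<close> to
  maximality over any type.\<close>

lemma saturated_baer_maximal:
  fixes \<Gamma> :: "('r, 'g, 'y) module_scheme"
  assumes "left_module R T"
    and "JT_extension R J T M s \<Gamma> \<iota> \<tau>" "saturated J T \<Gamma> \<tau>" "baer R J \<Gamma>"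
  shows "maximal_JT_extension TYPE('n) R J T M s \<Gamma> \<iota> \<tau>"
  unfolding maximal_JT_extension_def
proof (intro conjI allI impI assms)
  fix N :: "('r, 'n) module" and i t
  assume "JT_extension R J T M s N i t"
  then show "\<exists>f. JT_map R J M N i t \<Gamma> \<iota> \<tau> f"
    using JT_map_to_saturated_baer[OF assms] by metis
qed

text \<open>Injectivity is automatic. If f x = 0, choose I with \<open>I x \<subseteq> i(M)\<close>;
  as f i = j is injective, I x = 0, so x is torsion, and then t x = u (f x) = 0 gives x = 0. The
  colon condition is inherited from j(M), which lies in f(N).\<close>

lemma JT_map_extension:
  assumes T: "left_module R T"
    and N: "JT_extension R J T M s N i t" and P: "JT_extension R J T M s P j u"
    and f: "JT_map R J M N i t P j u f"
  shows "JT_extension R J T N t P f u"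
proof -
  note N' = JT_extensionD[OF N] and P' = JT_extensionD[OF P]
  interpret i: left_module_homomorphism R M N i
    by (rule N'(1))
  interpret j: left_module_homomorphism R M P j
    by (rule P'(1))
  note f' = JT_mapD[OF f i.B.left_module_axioms j.B.left_module_axioms]
  interpret f: left_module_homomorphism R N P f
    by (rule f'(1))
  have torsN: "submodule (torsion J N) R N" and torsP: "submodule (torsion J P) R P"
    by (rule torsion_submodule, rule i.B.left_module_axioms)
      (rule torsion_submodule, rule j.B.left_module_axioms)
  note t = i.B.submodule_hom[OF T torsN N'(4)] and u = j.B.submodule_hom[OF T torsP P'(4)]
  have "inj_on f (carrier N)"
    unfolding f.inj_on_iff_kernel
  proof (intro ballI impI)
    fix x assume x: "x \<in> carrier N" "f x = \<zero>\<^bsub>P\<^esub>"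
    then obtain I where I: "I \<in> J" "\<And>a. a \<in> I \<Longrightarrow> a \<odot>\<^bsub>N\<^esub> x \<in> i ` carrier M"
      using N'(7) by blast
    have "a \<odot>\<^bsub>N\<^esub> x = \<zero>\<^bsub>N\<^esub>" if a: "a \<in> I" for a
    proof -
      obtain m where m: "m \<in> carrier M" "a \<odot>\<^bsub>N\<^esub> x = i m"
        using I(2)[OF a] by blast
      have "j m = f (a \<odot>\<^bsub>N\<^esub> x)"
        using m f'(3) by simp
      also have "\<dots> = \<zero>\<^bsub>P\<^esub>"
        using x filter_carrier[OF I(1) a] by (simp add: f.hom_smult j.B.smult_r_null)
      finally show ?thesis
        using P'(2) m i.hom_zero unfolding j.inj_on_iff_kernel by simp
    qed
    then have tx: "x \<in> torsion J N"
      using I(1) x(1) by (auto simp: torsion_iff)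
    then have "t x = t \<zero>\<^bsub>N\<^esub>"
      using f'(2)[OF tx] x(2) by (simp add: t(4) u(4))
    from N'(5) this tx i.B.left_submoduleD(2)[OF torsN] show "x = \<zero>\<^bsub>N\<^esub>"
      by (rule inj_onD)
  qed
  moreover have "colon J P (f ` carrier N) = carrier P"
  proof
    have "carrier P = colon J P (j ` carrier M)"
      using P'(3) by simp
    also have "j ` carrier M = f ` i ` carrier M"
      using f'(3) by (auto simp: image_image)
    also have "colon J P (f ` i ` carrier M) \<subseteq> colon J P (f ` carrier N)"
      using i.hom_closed by (intro colon_mono) auto
    finally show "carrier P \<subseteq> colon J P (f ` carrier N)" .
  qed (auto simp: colon_iff)
  ultimately show ?thesis
    using N P f' f.hom
    by (simp add: JT_extension_def J_extension_def pointed_map_def pointed_module_def)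
qed

text \<open>A retraction \<open>p\<close> of \<open>f\<close> exists as \<open>N\<close> is injective; \<open>x - f (p x)\<close> is torsion, hence in the image
  of \<open>f\<close> as \<open>N\<close> is saturated.\<close>

lemma JT_map_from_saturated_baer:
  assumes T: "left_module R T"
    and N: "JT_extension R J T M s N i t" "saturated J T N t" "baer R J N"
    and P: "JT_extension R J T M s P j u"
    and f: "JT_map R J M N i t P j u f"
  shows "bij_betw f (carrier N) (carrier P)"
proof -
  note N' = JT_extensionD[OF N(1)] and P' = JT_extensionD[OF P]
    and E = JT_extensionD[OF JT_map_extension[OF T N(1) P f]]
  interpret f: left_module_homomorphism R N P f
    by (rule E(1))
  have torsP: "submodule (torsion J P) R P"
    by (rule torsion_submodule, rule f.B.left_module_axioms)
  note u = f.B.submodule_hom[OF T torsP P'(4)]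
  define g where "g = inv_into (carrier N) f"
  have gf: "g (f x) = x" if "x \<in> carrier N" for x
    using that E(2) by (simp add: g_def)
  have "g \<in> left_module_hom R (P\<lparr>carrier := f ` carrier N\<rparr>) N"
    by (rule left_module_homI)
      (auto simp: gf f.A.smult_closed simp flip: f.hom_add f.hom_smult)
  then obtain p where p: "p \<in> left_module_hom R P N" "\<And>x. x \<in> f ` carrier N \<Longrightarrow> p x = g x"
    using baer_extend[OF N(3) f.A.left_module_axioms f.B.left_module_axioms
        f.image_submodule[OF f.A.left_submodule_carrier] equalityD2[OF E(3)]] by metis
  have "x \<in> f ` carrier N" if x: "x \<in> carrier P" for x
  proof -
    have px: "p x \<in> carrier N"
      using left_module_homD(1)[OF p(1) x] .
    define c where "c = x \<ominus>\<^bsub>P\<^esub> f (p x)"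
    have c: "c \<in> carrier P"
      using x px by (simp add: c_def f.hom_closed)
    obtain I where I: "I \<in> J" "\<And>a. a \<in> I \<Longrightarrow> a \<odot>\<^bsub>P\<^esub> x \<in> f ` carrier N"
      using E(7)[OF x] by blast
    have "a \<odot>\<^bsub>P\<^esub> c = \<zero>\<^bsub>P\<^esub>" if a: "a \<in> I" for a
    proof -
      have aR: "a \<in> carrier R"
        using filter_carrier I(1) a .
      obtain y where y: "y \<in> carrier N" "a \<odot>\<^bsub>P\<^esub> x = f y"
        using I(2)[OF a] by blast
      have "a \<odot>\<^bsub>P\<^esub> f (p x) = f (p (a \<odot>\<^bsub>P\<^esub> x))"
        using aR x px left_module_homD(3)[OF p(1)] by (simp add: f.hom_smult)
      also have "\<dots> = a \<odot>\<^bsub>P\<^esub> x"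
        using y p(2) gf by simp
      finally show ?thesis
        using aR x px f.B.smult_closed
        by (simp add: c_def f.B.smult_r_diff f.hom_closed f.B.M.minus_eq_zero_iff)
    qed
    then have ct: "c \<in> torsion J P"
      using I(1) c by (auto simp: torsion_iff)
    \<comment> \<open>Saturation of N provides a torsion element with the same value in
      \<open>T\<close> as c, and injectivity of u identifies c with its image.\<close>
    then obtain y where y: "y \<in> torsion J N" "u c = t y"
      using N(2) u(1) unfolding saturated_def by blast
    have "u c = u (f y)"
      using y(2) E(6)[OF y(1)] by simp
    from P'(5) this ct have "c = f y"
      by (rule inj_onD) (rule f.hom_torsion[OF filtered_ring_axioms y(1)])
    moreover have "f (p x) \<oplus>\<^bsub>P\<^esub> c = x"
      unfolding c_def using x px by (intro f.B.M.add_minus_cancel f.hom_closed)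
    ultimately have "x = f (p x) \<oplus>\<^bsub>P\<^esub> f y"
      by simp
    also have "\<dots> = f (p x \<oplus>\<^bsub>N\<^esub> y)"
      using px y(1) by (simp add: f.hom_add torsion_iff)
    finally show ?thesis
      using px y(1) by (auto simp: torsion_iff)
  qed
  then show ?thesis
    using E(2) f.hom_closed by (auto simp: bij_betw_def)
qed

text \<open>The inverse map respects the maps to \<open>T\<close> because an injective f reflects
  torsion.\<close>

lemma JT_iso_if_bij:
  assumes T: "left_module R T"
    and N: "JT_extension R J T M s N i t" and P: "JT_extension R J T M s P j u"
    and f: "JT_map R J M N i t P j u f" and bij: "bij_betw f (carrier N) (carrier P)"
  shows "JT_iso R J M N i t P j u"
proof -
  note E = JT_extensionD[OF JT_map_extension[OF T N P f]]
  interpret f: left_module_homomorphism R N P f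
    by (rule E(1))
  interpret i: left_module_homomorphism R M N i
    by (rule JT_extensionD(1)[OF N])
  define g where "g = inv_into (carrier N) f"
  have g: "g y \<in> carrier N" "f (g y) = y" if "y \<in> carrier P" for y
    using that bij by (auto simp: g_def bij_betw_def inv_into_into f_inv_into_f)
  have gf: "g (f x) = x" if "x \<in> carrier N" for x
    using that E(2) by (simp add: g_def)
  have "g \<in> left_module_hom R P N"
    by (rule left_module_homI)
      (auto intro!: inj_onD[OF E(2)] simp: g f.A.smult_closed f.B.smult_closed f.hom_add f.hom_smult)
  moreover have "t (g y) = u y" if y: "y \<in> torsion J P" for y
  proof -
    have yP: "y \<in> carrier P"
      using y by (simp add: torsion_iff)
    then have "g y \<in> torsion J N"
      using f.torsion_reflect[OF filtered_ring_axioms E(2)] g y by metis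
    then show ?thesis
      using E(6) g(2)[OF yP] by metis
  qed
  moreover have "g (j m) = i m" if "m \<in> carrier M" for m
    using that f gf[of "i m"] i.hom_closed by (simp add: JT_map_def)
  ultimately have "JT_map R J M P j u N i t g"
    by (simp add: JT_map_def pointed_map_def)
  then show ?thesis
    unfolding JT_iso_def using f gf g(2) by blast
qed

end

section \<open>From the universe to arbitrary types\<close>

lemma saturated_baer_univ_extension:
  fixes R :: "('r, 'k) ring_scheme" and T :: "('r, 't, 'z) module_scheme"
    and M :: "('r, 'm, 'x) module_scheme"
  assumes "complete_filtered_ring R J" "left_module R T" "is_torsion J T" "baer R J T"
    and "pointed_module R J T M s"
  obtains \<Gamma> :: "('r, ('r, 'm, 't) univ) module" and \<iota> \<tau>
  where "JT_extension R J T M s \<Gamma> \<iota> \<tau>" "saturated J T \<Gamma> \<tau>" "baer R J \<Gamma>"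
proof -
  interpret pointed_module_setting R J T M s
    using assms by (simp add: pointed_module_setting_def pointed_module_setting_axioms_def
        pointed_module_def)
  obtain N :: "('r, (('r set \<times> ('r \<Rightarrow> 'm) \<Rightarrow> 'r) \<times> 't) set) module" and i t
    where N: "JT_extension R J T M s N i t" "saturated J T N t" "baer R J N"
    by (rule saturated_baer_extension)
  obtain e :: "_ \<Rightarrow> ('r, 'm, 't) univ" where "inj_on e (carrier N)"
    by (rule JT_extension_code[OF N(1)])
  from saturated_baer_copy[OF assms(2) N this] that show thesis
    by blast
qed

text \<open>One test object suffices: the saturated injective extension N on \<open>univ\<close>.
  Maximality gives a map from N to \<Gamma>, which is bijective by
  \<open>JT_map_from_saturated_baer\<close> and carries both properties over. The type of \<Gamma>
  itself is arbitrary.\<close>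

lemma maximal_imp_saturated_baer:
  fixes R :: "('r, 'k) ring_scheme" and T :: "('r, 't, 'z) module_scheme"
    and M :: "('r, 'm, 'x) module_scheme" and \<Gamma> :: "('r, 'g, 'y) module_scheme"
  assumes R: "complete_filtered_ring R J" and T: "left_module R T" "is_torsion J T" "baer R J T"
    and M: "pointed_module R J T M s"
    and max: "maximal_JT_extension TYPE(('r, 'm, 't) univ) R J T M s \<Gamma> \<iota> \<tau>"
  shows "JT_extension R J T M s \<Gamma> \<iota> \<tau>" "saturated J T \<Gamma> \<tau>" "baer R J \<Gamma>"
proof -
  interpret complete_filtered_ring R J
    by (rule R)
  show ext: "JT_extension R J T M s \<Gamma> \<iota> \<tau>"
    using max by (simp add: maximal_JT_extension_def)
  obtain N :: "('r, ('r, 'm, 't) univ) module" and i t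
    where N: "JT_extension R J T M s N i t" "saturated J T N t" "baer R J N"
    by (rule saturated_baer_univ_extension[OF R T M])
  obtain f where f: "JT_map R J M N i t \<Gamma> \<iota> \<tau> f"
    using max N(1) unfolding maximal_JT_extension_def by blast
  have bij: "bij_betw f (carrier N) (carrier \<Gamma>)"
    by (rule JT_map_from_saturated_baer[OF T(1) N ext f])
  have E: "JT_extension R J T N t \<Gamma> f \<tau>"
    by (rule JT_map_extension[OF T(1) N(1) ext f])
  interpret f: left_module_homomorphism R N \<Gamma> f
    by (rule JT_extensionD(1)[OF E])
  show "baer R J \<Gamma>"
    by (rule f.baer_iso[OF filtered_ring_axioms bij N(3)])
  have "carrier T \<subseteq> \<tau> ` torsion J \<Gamma>"
  proof
    fix x assume "x \<in> carrier T"
    then obtain n where n: "n \<in> torsion J N" "x = t n"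
      using N(2) unfolding saturated_def by blast
    then have "x = \<tau> (f n)"
      using JT_extensionD(6)[OF E] by simp
    then show "x \<in> \<tau> ` torsion J \<Gamma>"
      using f.hom_torsion[OF filtered_ring_axioms n(1)] by blast
  qed
  moreover have "\<tau> ` torsion J \<Gamma> \<subseteq> carrier T"
    using left_module_homD(1)[OF JT_extensionD(4)[OF ext]] by auto
  ultimately show "saturated J T \<Gamma> \<tau>"
    unfolding saturated_def by blast
qed

text \<open>Hypotheses of maximality refer to \<open>univ\<close>, whereas the types
  \<open>'g\<close>, \<open>'h\<close>, \<open>'n\<close>, \<open>'p\<close>, \<open>'a\<close> and
  \<open>'b\<close> of the conclusions are free. The bridge is the characterisation by
  \<open>saturated\<close> and \<open>baer\<close>, neither of which refers to a type of test
  modules.\<close>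

theorem theorem3p38:
  fixes R :: "('r, 'k) ring_scheme"
    and J :: "'r set set"
    and T :: "('r, 't) module"
    and M :: "('r, 'm) module"
    and s :: "'m \<Rightarrow> 't"
  assumes "ring R"
    and "ideal_filter R J"
    and "complete_filter TYPE(('r, 'm, 't) univ) R J"
    and "left_module R T"
    and "is_torsion J T"
    and "J_injective TYPE(('r, 'm, 't) univ) TYPE(('r, 'm, 't) univ) R J T"
    and "pointed_module R J T M s"
  shows
    "(\<exists>(\<Gamma> :: ('r, ('r, 'm, 't) univ) module) \<iota> \<tau>.
        maximal_JT_extension TYPE(('r, 'm, 't) univ) R J T M s \<Gamma> \<iota> \<tau>) \<and>
     (\<forall>(\<Gamma> :: ('r, 'g) module) \<iota> \<tau>.
        maximal_JT_extension TYPE(('r, 'm, 't) univ) R J T M s \<Gamma> \<iota> \<tau> \<longrightarrow>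
          maximal_JT_extension TYPE('n) R J T M s \<Gamma> \<iota> \<tau> \<and>
          (\<forall>(\<Gamma>' :: ('r, 'h) module) \<iota>' \<tau>'.
             maximal_JT_extension TYPE(('r, 'm, 't) univ) R J T M s \<Gamma>' \<iota>' \<tau>' \<longrightarrow>
             JT_iso R J M \<Gamma> \<iota> \<tau> \<Gamma>' \<iota>' \<tau>') \<and>
          saturated J T \<Gamma> \<tau> \<and>
          J_injective TYPE('a) TYPE('b) R J \<Gamma> \<and>
          (\<forall>(N :: ('r, 'n) module) i t \<phi>.
             JT_extension R J T M s N i t \<and> JT_map R J M N i t \<Gamma> \<iota> \<tau> \<phi> \<longrightarrow>
             maximal_JT_extension TYPE('p) R J T N t \<Gamma> \<phi> \<tau>))"
proof -
  \<comment> \<open>Singletons embed R into \<open>univ\<close>, which makes the hypotheses on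
    completeness and injectivity applicable to a copy of R.\<close>
  define e :: "'r \<Rightarrow> ('r, 'm, 't) univ" where "e r = {(0, r, undefined, undefined)}" for r
  have e: "inj_on e (carrier R)"
    by (simp add: e_def inj_on_def)
  have FR: "filtered_ring R J"
    using assms(1,2) by (simp add: filtered_ring_def filtered_ring_axioms_def)
  then interpret complete_filtered_ring R J
    using complete_filter_left_ideal[OF FR assms(3) e]
    by (simp add: complete_filtered_ring_def complete_filtered_ring_axioms_def)
  have CR: "complete_filtered_ring R J"
    by (rule complete_filtered_ring_axioms)
  note T = assms(4,5) J_injective_imp_baer[OF FR assms(6) e]
  show ?thesis
  proof (intro conjI allI impI)
    obtain \<Gamma> :: "('r, ('r, 'm, 't) univ) module" and \<iota> \<tau>
      where "JT_extension R J T M s \<Gamma> \<iota> \<tau>" "saturated J T \<Gamma> \<tau>" "baer R J \<Gamma>"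
      by (rule saturated_baer_univ_extension[OF CR T assms(7)])
    from saturated_baer_maximal[OF T(1) this]
    show "\<exists>(\<Gamma> :: ('r, ('r, 'm, 't) univ) module) \<iota> \<tau>.
        maximal_JT_extension TYPE(('r, 'm, 't) univ) R J T M s \<Gamma> \<iota> \<tau>"
      by blast
  next
    fix \<Gamma> :: "('r, 'g) module" and \<iota> \<tau>
    assume max: "maximal_JT_extension TYPE(('r, 'm, 't) univ) R J T M s \<Gamma> \<iota> \<tau>"
    note \<Gamma> = maximal_imp_saturated_baer[OF CR T assms(7) max]
    show "maximal_JT_extension TYPE('n) R J T M s \<Gamma> \<iota> \<tau>"
      by (rule saturated_baer_maximal[OF T(1) \<Gamma>])
    show "saturated J T \<Gamma> \<tau>"
      by (rule \<Gamma>(2))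
    have "left_module R \<Gamma>"
      using \<Gamma>(1) by (simp add: JT_extension_def J_extension_def)
    then show "J_injective TYPE('a) TYPE('b) R J \<Gamma>"
      by (rule baer_imp_J_injective[OF \<Gamma>(3)])
    show "JT_iso R J M \<Gamma> \<iota> \<tau> \<Gamma>' \<iota>' \<tau>'"
      if max': "maximal_JT_extension TYPE(('r, 'm, 't) univ) R J T M s \<Gamma>' \<iota>' \<tau>'"
      for \<Gamma>' :: "('r, 'h) module" and \<iota>' \<tau>'
    proof -
      note \<Gamma>' = maximal_imp_saturated_baer[OF CR T assms(7) max']
      obtain f where f: "JT_map R J M \<Gamma> \<iota> \<tau> \<Gamma>' \<iota>' \<tau>' f"
        by (rule JT_map_to_saturated_baer[OF T(1) \<Gamma>' \<Gamma>(1)])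
      show ?thesis
        by (rule JT_iso_if_bij[OF T(1) \<Gamma>(1) \<Gamma>'(1) f])
          (rule JT_map_from_saturated_baer[OF T(1) \<Gamma> \<Gamma>'(1) f])
    qed
    \<comment> \<open>Over N the module \<Gamma> is again an extension, by
      \<open>JT_map_extension\<close>. Being saturated and injective does not refer to the base
      module, so both properties persist and give maximality.\<close>
    show "maximal_JT_extension TYPE('p) R J T N t \<Gamma> \<phi> \<tau>"
      if "JT_extension R J T M s N i t \<and> JT_map R J M N i t \<Gamma> \<iota> \<tau> \<phi>"
      for N :: "('r, 'n) module" and i t \<phi>
      using that JT_map_extension[OF T(1) _ \<Gamma>(1)] \<Gamma>(2,3)
      by (intro saturated_baer_maximal T(1)) blast+
  qed
qed

end
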